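(* Let $\mathcal T$ be a $\lambda$-theory with $\mathcal B\subseteq\mathcal T$. Then $\mathrm{HP}/\mathcal T$ (the set of $\mathcal T$-equivalence classes of hereditary permutations) is a submonoid of the semigroup $(\Lambda/\mathcal T,\circ)$ which is an $E$-unitary inverse monoid.
   Context: $\Lambda$ is the set of $\lambda$-terms; $\mathbf I=\lambda x.x$, $\mathbf B=\lambda fgx.f(gx)$, $M\circ N:=\mathbf BMN$, which induces an associative operation on $\Lambda/\mathcal T$ for any $\lambda$-theory $\mathcal T$ (an equivalence on $\Lambda$ containing $\beta$-conversion, compatible with application and abstraction). $\mathcal B$ is the $\lambda$-theory equating two terms iff they have the same Böhm tree. For each variable $x$, $\mathscr{HP}(x)$ is the largest set of Böhm-like trees such that every $T\in\mathscr{HP}(x)$ has the form $\lambda x_1\ldots x_n.x\,T_1\cdots T_n$ (root $\lambda x_1\dots x_n.x$, children $T_i$, $x_i$ fresh) for some $n$, some permutation $\pi$ of $\{1,\dots,n\}$ and $T_i\in\mathscr{HP}(x_{\pi i})$; $\mathscr{HP}=\{\lambda x.T:T\in\mathscr{HP}(x)\}$, and $\mathrm{HP}=\{M\in\Lambda:\mathrm{BT}(M)\in\mathscr{HP}\}$. An inverse monoid is a monoid with a unary operation $^*$ satisfying $(u^* )^*=u$, $(uv)^*=v^*u^*$, $uu^*u=u$, $uu^*vv^*=vv^*uu^*$; its natural order is $u\le v$ iff $uu^*v=u$; it is $E$-unitary if whenever $e$ is idempotent and $e\le v$, then $v$ is idempotent. *)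

theory Defs
  imports "HOL-Algebra.Group" "HOL-Combinatorics.Permutations"
begin

section \<open>Lambda terms and lambda theories\<close>

text \<open>Terms modulo alpha-conversion, in de Bruijn notation; open terms are included, a free variable
  being an index that exceeds the number of enclosing abstractions.\<close>

datatype trm = Var nat | App trm trm | Abs trm

primrec lift :: "trm \<Rightarrow> nat \<Rightarrow> trm" where
  "lift (Var i) k = (if i < k then Var i else Var (Suc i))"
| "lift (App s t) k = App (lift s k) (lift t k)"
| "lift (Abs s) k = Abs (lift s (Suc k))"

text \<open>\<open>subst s u k\<close> replaces index \<open>k\<close> by \<open>u\<close> and, since a binder disappears, decrements the larger
  indices.\<close>

primrec subst :: "trm \<Rightarrow> trm \<Rightarrow> nat \<Rightarrow> trm" where
  "subst (Var i) u k = (if k < i then Var (i - 1) else if i = k then u else Var i)"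
| "subst (App s t) u k = App (subst s u k) (subst t u k)"
| "subst (Abs s) u k = Abs (subst s (lift u 0) (Suc k))"

inductive beta :: "trm \<Rightarrow> trm \<Rightarrow> bool" where
  redex: "beta (App (Abs s) t) (subst s t 0)"
| appL: "beta s s' \<Longrightarrow> beta (App s t) (App s' t)"
| appR: "beta t t' \<Longrightarrow> beta (App s t) (App s t')"
| abs: "beta s s' \<Longrightarrow> beta (Abs s) (Abs s')"

abbreviation beta_conv :: "trm \<Rightarrow> trm \<Rightarrow> bool" where
  "beta_conv \<equiv> equivclp beta"

locale lambda_theory =
  fixes T :: "trm rel"
  assumes equiv: "equiv UNIV T"
    and beta_conv: "beta_conv M N \<Longrightarrow> (M, N) \<in> T"
    and app: "(M, M') \<in> T \<Longrightarrow> (N, N') \<in> T \<Longrightarrow> (App M N, App M' N') \<in> T"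
    and abs: "(M, N) \<in> T \<Longrightarrow> (Abs M, Abs N) \<in> T"

definition I_trm :: trm where
  "I_trm = Abs (Var 0)"

definition B_trm :: trm where
  "B_trm = Abs (Abs (Abs (App (Var 2) (App (Var 1) (Var 0)))))"

definition comp_trm :: "trm \<Rightarrow> trm \<Rightarrow> trm" where
  "comp_trm M N = App (App B_trm M) N"

section \<open>Boehm trees\<close>

text \<open>\<open>lams n M\<close> is \<open>\<lambda>x\<^sub>1\<dots>x\<^sub>n. M\<close> and \<open>apps M [N\<^sub>1, \<dots>, N\<^sub>m]\<close> is \<open>M N\<^sub>1 \<dots> N\<^sub>m\<close>.\<close>

abbreviation lams :: "nat \<Rightarrow> trm \<Rightarrow> trm" where
  "lams n M \<equiv> (Abs ^^ n) M"

abbreviation apps :: "trm \<Rightarrow> trm list \<Rightarrow> trm" where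
  "apps \<equiv> foldl App"

inductive head_red :: "trm \<Rightarrow> trm \<Rightarrow> bool" where
  "head_red (lams n (apps (App (Abs P) Q) Ns)) (lams n (apps (subst P Q 0) Ns))"

definition hnf :: "nat \<times> nat \<times> trm list \<Rightarrow> trm" where
  "hnf = (\<lambda>(n, y, Ns). lams n (apps (Var y) Ns))"

text \<open>The principal head normal form, in which the head reduction of \<open>M\<close> terminates, if any.\<close>

definition phnf :: "trm \<Rightarrow> (nat \<times> nat \<times> trm list) option" where
  "phnf M = (if \<exists>h. head_red\<^sup>*\<^sup>* M (hnf h) then Some (THE h. head_red\<^sup>*\<^sup>* M (hnf h)) else None)"

lemma lams_inject:
  "lams n s = lams m t \<Longrightarrow> (\<forall>u. s \<noteq> Abs u) \<Longrightarrow> (\<forall>u. t \<noteq> Abs u) \<Longrightarrow> n = m \<and> s = t"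
proof (induction n arbitrary: m)
  case 0
  then show ?case by (cases m) auto
next
  case (Suc n)
  then show ?case by (cases m) auto
qed

lemma apps_inject:
  "apps s Ns = apps t Ms \<Longrightarrow> (\<forall>u v. s \<noteq> App u v) \<Longrightarrow> (\<forall>u v. t \<noteq> App u v) \<Longrightarrow> s = t \<and> Ns = Ms"
proof (induction Ns arbitrary: Ms rule: rev_induct)
  case Nil
  then show ?case by (cases Ms rule: rev_cases) auto
next
  case (snoc N Ns)
  note IH = snoc.IH and prems = snoc.prems
  show ?case
  proof (cases Ms rule: rev_cases)
    case Nil
    with prems show ?thesis by auto
  next
    case (snoc Ms' M)
    then have "apps s Ns = apps t Ms'" "N = M"
      using prems(1) by simp_all
    then show ?thesis
      using IH[of Ms'] prems(2,3) snoc by blast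
  qed
qed

lemma apps_not_Abs: "(\<forall>u. s \<noteq> Abs u) \<Longrightarrow> apps s Ns \<noteq> Abs v"
  by (induction Ns rule: rev_induct) auto

lemma hnf_inject:
  assumes "hnf h = hnf h'"
  shows "h = h'"
proof -
  obtain n y Ns m z Ms where h: "h = (n, y, Ns)" "h' = (m, z, Ms)"
    by (cases h, cases h') blast
  have "n = m \<and> apps (Var y) Ns = apps (Var z) Ms"
    using assms unfolding h hnf_def prod.case
    by (rule lams_inject) (simp_all add: apps_not_Abs)
  then show ?thesis
    using apps_inject[of "Var y" Ns "Var z" Ms] by (simp add: h)
qed

lemma head_redex_inject:
  assumes "lams n (apps (App (Abs P) Q) Ns) = lams m (apps (App (Abs P') Q') Ms)"
  shows "n = m \<and> P = P' \<and> Q = Q' \<and> Ns = Ms"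
proof -
  have "n = m \<and> apps (Abs P) (Q # Ns) = apps (Abs P') (Q' # Ms)"
    using lams_inject[OF assms] by (simp add: apps_not_Abs)
  then show ?thesis
    using apps_inject[of "Abs P" "Q # Ns" "Abs P'" "Q' # Ms"] by simp
qed

lemma head_red_deterministic:
  assumes "head_red M N" "head_red M N'"
  shows "N = N'"
proof -
  obtain n P Q Ns where 1: "M = lams n (apps (App (Abs P) Q) Ns)" "N = lams n (apps (subst P Q 0) Ns)"
    using assms(1) by (rule head_red.cases)
  obtain m P' Q' Ms where 2: "M = lams m (apps (App (Abs P') Q') Ms)" "N' = lams m (apps (subst P' Q' 0) Ms)"
    using assms(2) by (rule head_red.cases)
  have "n = m \<and> P = P' \<and> Q = Q' \<and> Ns = Ms"
    using 1(1) 2(1) by (intro head_redex_inject) simp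
  then show ?thesis
    by (simp add: 1(2) 2(2))
qed

lemma hnf_head_normal: "\<not> head_red (hnf h) N"
proof
  assume "head_red (hnf h) N"
  then obtain n y Ms m P Q Ns where
    "lams n (apps (Var y) Ms) = lams m (apps (App (Abs P) Q) Ns)"
    by (cases h) (metis head_red.cases hnf_def case_prod_conv)
  then have "apps (Var y) Ms = apps (Abs P) (Q # Ns)"
    using lams_inject[of n "apps (Var y) Ms" m "apps (App (Abs P) Q) Ns"]
    by (simp add: apps_not_Abs)
  then show False
    using apps_inject[of "Var y" Ms "Abs P" "Q # Ns"] by simp
qed

lemma principal_hnf_unique:
  "head_red\<^sup>*\<^sup>* M (hnf h) \<Longrightarrow> head_red\<^sup>*\<^sup>* M (hnf h') \<Longrightarrow> h = h'"
proof (induction M rule: converse_rtranclp_induct)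
  case base
  then show ?case
    by (metis converse_rtranclpE hnf_head_normal hnf_inject)
next
  case (step M N)
  from step.prems show ?case
  proof (cases rule: converse_rtranclpE)
    case base
    with step.hyps show ?thesis by (simp add: hnf_head_normal)
  next
    case (step N')
    with step.hyps step.IH head_red_deterministic show ?thesis by blast
  qed
qed

lemma phnf_eq: "phnf M = Some h \<longleftrightarrow> head_red\<^sup>*\<^sup>* M (hnf h)"
proof
  assume h: "head_red\<^sup>*\<^sup>* M (hnf h)"
  then have "(THE h. head_red\<^sup>*\<^sup>* M (hnf h)) = h"
    by (blast intro: principal_hnf_unique)
  with h show "phnf M = Some h"
    unfolding phnf_def by metis
next
  assume h: "phnf M = Some h"
  then obtain h' where h': "head_red\<^sup>*\<^sup>* M (hnf h')"
    unfolding phnf_def by (metis option.distinct(1))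
  then have "(THE h. head_red\<^sup>*\<^sup>* M (hnf h)) = h'"
    by (blast intro: principal_hnf_unique)
  with h h' show "head_red\<^sup>*\<^sup>* M (hnf h)"
    unfolding phnf_def by (metis option.inject)
qed

text \<open>Boehm-like trees: \<open>Node n y [T\<^sub>1, \<dots>, T\<^sub>m]\<close> has the root \<open>\<lambda>x\<^sub>1\<dots>x\<^sub>n. y\<close> and the children
  \<open>T\<^sub>1, \<dots>, T\<^sub>m\<close>. The index \<open>y\<close> and the free indices of the children live below the \<open>n\<close> binders,
  so that \<open>x\<^sub>i\<close> is the index \<open>n - i\<close>.\<close>

codatatype btree = Bot | Node nat nat "btree list"

primcorec BT :: "trm \<Rightarrow> btree" where
  "BT M = (case phnf M of None \<Rightarrow> Bot | Some h \<Rightarrow>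
    Node (fst h) (fst (snd h)) (map BT (snd (snd h))))"

lemma BT_hnf: "head_red\<^sup>*\<^sup>* M (hnf (n, y, Ns)) \<Longrightarrow> BT M = Node n y (map BT Ns)"
  by (subst BT.code) (simp add: phnf_eq[symmetric])

lemma BT_Bot: "\<nexists>h. head_red\<^sup>*\<^sup>* M (hnf h) \<Longrightarrow> BT M = Bot"
  by (subst BT.code) (simp add: phnf_def)

definition bt_theory :: "trm rel" where
  "bt_theory = {(M, N). BT M = BT N}"

section \<open>Hereditary permutations\<close>

text \<open>\<open>HP_tree_at k\<close> is the set written \<open>HP(x)\<close> for the variable \<open>x\<close> of index \<open>k\<close>. With \<open>\<pi>\<close> permuting
  \<open>{0, \<dots>, n - 1}\<close> instead of \<open>{1, \<dots>, n}\<close>, the variable \<open>x\<close> of index \<open>\<pi> i\<close> in the list of bound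
  variables is the de Bruijn index \<open>n - Suc (\<pi> i)\<close>.\<close>

coinductive HP_tree_at :: "nat \<Rightarrow> btree \<Rightarrow> bool" where
  "\<lbrakk>\<pi> permutes {..<n}; length Ts = n; \<forall>i<n. HP_tree_at (n - Suc (\<pi> i)) (Ts ! i)\<rbrakk>
    \<Longrightarrow> HP_tree_at k (Node n (n + k) Ts)"

text \<open>The tree \<open>\<lambda>x. T\<close>, where \<open>x\<close> is the index \<open>0\<close> of \<open>T\<close>; \<open>\<lambda>x. \<bottom>\<close> is \<open>\<bottom>\<close>.\<close>

definition bt_abs :: "btree \<Rightarrow> btree" where
  "bt_abs T = (case T of Bot \<Rightarrow> Bot | Node n y Ts \<Rightarrow> Node (Suc n) y Ts)"

definition HP_tree :: "btree set" where
  "HP_tree = {bt_abs T |T. HP_tree_at 0 T}"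

definition HP :: "trm set" where
  "HP = {M. BT M \<in> HP_tree}"

section \<open>Inverse monoids\<close>

locale inverse_monoid = monoid G for G (structure) +
  fixes star :: "'a \<Rightarrow> 'a"
  assumes star_closed: "u \<in> carrier G \<Longrightarrow> star u \<in> carrier G"
    and star_star: "u \<in> carrier G \<Longrightarrow> star (star u) = u"
    and star_mult: "\<lbrakk>u \<in> carrier G; v \<in> carrier G\<rbrakk> \<Longrightarrow> star (u \<otimes> v) = star v \<otimes> star u"
    and mult_star_mult: "u \<in> carrier G \<Longrightarrow> u \<otimes> star u \<otimes> u = u"
    and mult_star_commute: "\<lbrakk>u \<in> carrier G; v \<in> carrier G\<rbrakk>
      \<Longrightarrow> u \<otimes> star u \<otimes> v \<otimes> star v = v \<otimes> star v \<otimes> u \<otimes> star u"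
begin

definition nat_le :: "'a \<Rightarrow> 'a \<Rightarrow> bool" where
  "nat_le u v \<longleftrightarrow> u \<otimes> star u \<otimes> v = u"

end

definition idempotent :: "('a, 'b) monoid_scheme \<Rightarrow> 'a \<Rightarrow> bool" where
  "idempotent G e \<longleftrightarrow> e \<in> carrier G \<and> e \<otimes>\<^bsub>G\<^esub> e = e"

locale E_unitary_inverse_monoid = inverse_monoid G star for G (structure) and star +
  assumes E_unitary: "\<lbrakk>idempotent G e; v \<in> carrier G; nat_le e v\<rbrakk> \<Longrightarrow> idempotent G v"

section \<open>The quotient by a lambda theory\<close>

text \<open>\<open>Lam_quot T\<close> is a semigroup with the operation induced by \<open>comp_trm\<close> (see \<open>mult_class\<close>,
  \<open>comp_assoc\<close> below). Its field \<open>one\<close> merely designates the class of \<open>I_trm\<close>, which in general is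
  not neutral in the whole of \<open>Lam_quot T\<close>.\<close>

definition Lam_quot :: "trm rel \<Rightarrow> trm set monoid" where
  "Lam_quot T = \<lparr>carrier = UNIV // T,
    monoid.mult = (\<lambda>U V. \<Union>M\<in>U. \<Union>N\<in>V. T `` {comp_trm M N}),
    one = T `` {I_trm}\<rparr>"

abbreviation HP_quot :: "trm rel \<Rightarrow> trm set monoid" where
  "HP_quot T \<equiv> (Lam_quot T)\<lparr>carrier := HP // T\<rparr>"

lemma subst_lift: "subst (lift t k) u k = t"
  by (induction t arbitrary: k u) auto

lemma lift_lift: "i \<le> k \<Longrightarrow> lift (lift t i) (Suc k) = lift (lift t k) i"
  by (induction t arbitrary: i k) auto

lemma subst_lift_lift: "subst (lift (lift t k) k) u (Suc k) = lift t k"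
  using subst_lift[of "lift t k" "Suc k" u] lift_lift[of k k t] by simp

lemma lift_comp: "lift (comp_trm M N) k = comp_trm (lift M k) (lift N k)"
  by (simp add: comp_trm_def B_trm_def)

context lambda_theory
begin

lemma T_refl: "(M, M) \<in> T"
  using equiv by (auto simp: equiv_def refl_on_def)

lemma T_sym: "(M, N) \<in> T \<Longrightarrow> (N, M) \<in> T"
  using equiv by (auto simp: equiv_def dest: symD)

lemma T_trans: "(M, N) \<in> T \<Longrightarrow> (N, P) \<in> T \<Longrightarrow> (M, P) \<in> T"
  using equiv by (auto simp: equiv_def dest: transD)

lemma beta_in: "beta M N \<Longrightarrow> (M, N) \<in> T"
  by (intro beta_conv) (auto simp: equivclp_def symclp_def)

lemma comp_cong: "(M, M') \<in> T \<Longrightarrow> (N, N') \<in> T \<Longrightarrow> (comp_trm M N, comp_trm M' N') \<in> T"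
  unfolding comp_trm_def by (intro app T_refl)

lemma mult_class: "T `` {M} \<otimes>\<^bsub>Lam_quot T\<^esub> T `` {N} = T `` {comp_trm M N}"
proof -
  have "(\<lambda>M N. T `` {comp_trm M N}) respects2 T"
    by (intro congruent2I' equiv_class_eq[OF equiv] comp_cong)
  then show ?thesis
    unfolding Lam_quot_def by (simp add: UN_equiv_class2[OF equiv equiv])
qed

lemma comp_eta: "(comp_trm M N, Abs (App (lift M 0) (App (lift N 0) (Var 0)))) \<in> T"
proof -
  have "beta (App B_trm M) (Abs (Abs (App (lift (lift M 0) 0) (App (Var 1) (Var 0)))))"
    using beta.redex[of "Abs (Abs (App (Var 2) (App (Var 1) (Var 0))))" M]
    by (simp add: B_trm_def numeral_2_eq_2)
  then have "(comp_trm M N, App (Abs (Abs (App (lift (lift M 0) 0) (App (Var 1) (Var 0))))) N) \<in> T"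
    unfolding comp_trm_def by (intro app T_refl beta_in)
  moreover have "beta (App (Abs (Abs (App (lift (lift M 0) 0) (App (Var 1) (Var 0))))) N)
      (Abs (App (lift M 0) (App (lift N 0) (Var 0))))"
    using beta.redex[of "Abs (App (lift (lift M 0) 0) (App (Var 1) (Var 0)))" N]
    by (simp add: subst_lift_lift)
  ultimately show ?thesis
    by (blast intro: T_trans beta_in)
qed

lemma comp_app: "(App (comp_trm M N) P, App M (App N P)) \<in> T"
proof -
  have "beta (App (Abs (App (lift M 0) (App (lift N 0) (Var 0)))) P) (App M (App N P))"
    using beta.redex[of "App (lift M 0) (App (lift N 0) (Var 0))" P] by (simp add: subst_lift)
  then show ?thesis
    by (blast intro: T_trans beta_in app comp_eta T_refl)
qed

lemma comp_assoc: "(comp_trm (comp_trm M N) P, comp_trm M (comp_trm N P)) \<in> T"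
proof -
  let ?C = "Abs (App (lift M 0) (App (lift N 0) (App (lift P 0) (Var 0))))"
  have "(Abs (App (lift (comp_trm M N) 0) (App (lift P 0) (Var 0))), ?C) \<in> T"
    unfolding lift_comp by (intro abs comp_app)
  moreover have "(Abs (App (lift M 0) (App (lift (comp_trm N P) 0) (Var 0))), ?C) \<in> T"
    unfolding lift_comp by (intro abs app T_refl comp_app)
  ultimately show ?thesis
    by (meson comp_eta T_trans T_sym)
qed

end

end

(*
Up to the theory B, a hereditary permutation is a finitely branching tree of finite permutations. The
permutations determine an automorphism of the full tree, the arities the subtree outside which the term
is only eta-expanded; composition multiplies the automorphisms and joins the subtrees. This makes the
hereditary permutations modulo B regular, with commuting idempotents, namely those with all permutations
trivial. The inverse tree has to be the Boehm tree of a term; this term interprets the given one by a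
compositional translation, so that it can find the arities and permutations by itself.

For a consistent T above B, a linear form of Boehm's separation shows that T-equal hereditary
permutations have the same permutations at all positions. Hence idempotents modulo T have trivial
permutations, and an element above such an idempotent has trivial permutations too.
*)
theory Submission
  imports Defs
begin

text \<open>A class does not determine its permutation tree: a theory above B may identify trees of
  different arities, as it does when it contains eta. Only the permutations are invariant, and for
  an inconsistent theory not even these. Hence trees and classes are linked by a relation, and each
  use of separation takes its witness of consistency from the inequality to be refuted. The
  involution is not read off the trees: regularity passes to every quotient, separation makes the
  idempotents commute, and inverses are then unique. Separation is linear because each variable
  heads exactly one node; replacing it by a projection leaves the selected subtree intact. The
  obstacle for inverses is that the inverse tree may be infinite and irregular, while a term cannot
  observe how many abstractions its argument starts with. In the translated copy, abstractions and
  head variables become visible.\<close>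

notation App (infixl "\<cdot>" 95)

section \<open>Parallel substitution\<close>

definition up :: "(nat \<Rightarrow> trm) \<Rightarrow> nat \<Rightarrow> trm" where
  "up \<sigma> i = (case i of 0 \<Rightarrow> Var 0 | Suc j \<Rightarrow> lift (\<sigma> j) 0)"

lemma up_simps [simp]: "up \<sigma> 0 = Var 0" "up \<sigma> (Suc i) = lift (\<sigma> i) 0"
  "up \<sigma> (numeral v) = lift (\<sigma> (pred_numeral v)) 0"
  by (simp_all add: up_def)

primrec inst :: "trm \<Rightarrow> (nat \<Rightarrow> trm) \<Rightarrow> trm" where
  "inst (Var i) \<sigma> = \<sigma> i"
| "inst (M \<cdot> N) \<sigma> = inst M \<sigma> \<cdot> inst N \<sigma>"
| "inst (Abs M) \<sigma> = Abs (inst M (up \<sigma>))"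

lemma lift_eq_inst: "lift M k = inst M (\<lambda>i. Var (if i < k then i else Suc i))"
proof (induction M arbitrary: k)
  case (Abs M)
  have "up (\<lambda>i. Var (if i < k then i else Suc i)) = (\<lambda>i. Var (if i < Suc k then i else Suc i))"
    by (auto simp: up_def fun_eq_iff split: nat.split)
  with Abs show ?case by simp
qed auto

lemma up_ren: "up (\<lambda>i. Var (f i)) = (\<lambda>i. Var (case i of 0 \<Rightarrow> 0 | Suc j \<Rightarrow> Suc (f j)))"
  by (auto simp: up_def fun_eq_iff split: nat.split)

lemma inst_ren: "inst (inst M (\<lambda>i. Var (f i))) \<sigma> = inst M (\<lambda>i. \<sigma> (f i))"
proof (induction M arbitrary: f \<sigma>)
  case (Abs M)
  have "(\<lambda>i. up \<sigma> (case i of 0 \<Rightarrow> 0 | Suc j \<Rightarrow> Suc (f j))) = up (\<lambda>i. \<sigma> (f i))"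
    by (auto simp: up_def fun_eq_iff split: nat.split)
  with Abs show ?case by (simp add: up_ren)
qed auto

lemma lift_inst_up: "inst (lift M 0) \<sigma> = inst M (\<lambda>i. \<sigma> (Suc i))"
  by (simp add: lift_eq_inst inst_ren)

lemma ren_inst: "inst (inst M \<sigma>) (\<lambda>i. Var (f i)) = inst M (\<lambda>i. inst (\<sigma> i) (\<lambda>i. Var (f i)))"
proof (induction M arbitrary: f \<sigma>)
  case (Abs M)
  have "(\<lambda>i. inst (up \<sigma> i) (\<lambda>i. Var (case i of 0 \<Rightarrow> 0 | Suc j \<Rightarrow> Suc (f j))))
      = up (\<lambda>i. inst (\<sigma> i) (\<lambda>i. Var (f i)))"
    by (auto simp: up_def fun_eq_iff lift_inst_up lift_eq_inst inst_ren split: nat.split)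
  with Abs show ?case by (simp add: up_ren)
qed auto

lemma lift_inst: "lift (inst M \<sigma>) 0 = inst M (\<lambda>i. lift (\<sigma> i) 0)"
  by (simp add: lift_eq_inst ren_inst[where f = Suc])

text \<open>Under a binder this needs \<open>lift\<close> to commute with \<open>inst\<close>, and
  \<open>lift\<close> is itself a renaming; hence the special cases with a renaming on either side
  come before.\<close>

lemma inst_inst: "inst (inst M \<sigma>) \<tau> = inst M (\<lambda>i. inst (\<sigma> i) \<tau>)"
proof (induction M arbitrary: \<sigma> \<tau>)
  case (Abs M)
  have "(\<lambda>i. inst (up \<sigma> i) (up \<tau>)) = up (\<lambda>i. inst (\<sigma> i) \<tau>)"
    by (auto simp: up_def fun_eq_iff lift_inst_up lift_inst split: nat.split)
  with Abs show ?case by simp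
qed auto

lemma up_Var: "up Var = Var"
  by (auto simp: up_def fun_eq_iff split: nat.split)

lemma inst_Var [simp]: "inst M Var = M"
  by (induction M) (auto simp: up_Var)

text \<open>Simultaneous form of \<open>subst\<close>. Index 0 is the innermost binder, so arguments
  fed to several abstractions enter the list in reverse.\<close>

definition senv :: "trm list \<Rightarrow> nat \<Rightarrow> trm" where
  "senv Xs i = (if i < length Xs then Xs ! i else Var (i - length Xs))"

lemma subst_eq_inst: "subst M u k = inst M (\<lambda>i. if k < i then Var (i - 1) else if i = k then u else Var i)"
proof (induction M arbitrary: u k)
  case (Abs M)
  have "up (\<lambda>i. if k < i then Var (i - 1) else if i = k then u else Var i)
    = (\<lambda>i. if Suc k < i then Var (i - 1) else if i = Suc k then lift u 0 else Var i)"
    by (auto simp: up_def fun_eq_iff split: nat.split)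
  with Abs show ?case by simp
qed auto

lemma subst_0: "subst M u 0 = inst M (senv [u])"
  unfolding subst_eq_inst by (rule arg_cong[of _ _ "inst M"]) (auto simp: senv_def fun_eq_iff)

lemma lift_senv: "inst (lift M 0) (senv [u]) = M"
  by (simp add: lift_inst_up senv_def)

lemma up_funpow_less: "i < d \<Longrightarrow> (up ^^ d) \<sigma> i = Var i"
  by (induction d arbitrary: i) (auto simp: up_def split: nat.split)

lemma up_funpow_add: "(up ^^ d) \<sigma> (i + d) = inst (\<sigma> i) (\<lambda>j. Var (j + d))"
  by (induction d) (simp_all add: lift_eq_inst inst_ren)

lemma inst_lams: "inst (lams n M) \<sigma> = lams n (inst M ((up ^^ n) \<sigma>))"
  by (induction n arbitrary: \<sigma>) (simp_all add: funpow_swap1[of up])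

lemma inst_apps [simp]: "inst (apps M Ns) \<sigma> = apps (inst M \<sigma>) (map (\<lambda>N. inst N \<sigma>) Ns)"
  by (induction Ns arbitrary: M) auto

text \<open>Finite support lets abstractions and applications imitate any substitution, which makes
  lambda theories closed under \<open>inst\<close>.\<close>

lemma inst_support: "\<exists>K. \<forall>\<sigma> \<tau>. (\<forall>i<K. \<sigma> i = \<tau> i) \<longrightarrow> inst M \<sigma> = inst M \<tau>"
proof (induction M)
  case (Var i)
  show ?case by (intro exI[of _ "Suc i"]) simp
next
  case (App M N)
  then obtain K L where
    "\<forall>\<sigma> \<tau>. (\<forall>i<K. \<sigma> i = \<tau> i) \<longrightarrow> inst M \<sigma> = inst M \<tau>"
    "\<forall>\<sigma> \<tau>. (\<forall>i<L. \<sigma> i = \<tau> i) \<longrightarrow> inst N \<sigma> = inst N \<tau>" by blast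
  then show ?case by (intro exI[of _ "max K L"]) (auto simp: less_max_iff_disj)
next
  case (Abs M)
  then obtain K where K: "\<And>\<sigma> \<tau>. (\<forall>i<K. \<sigma> i = \<tau> i) \<Longrightarrow> inst M \<sigma> = inst M \<tau>" by blast
  show ?case
    by (intro exI[of _ K]) (auto intro!: K simp: up_def split: nat.split)
qed

section \<open>Weak head reduction\<close>

inductive whr :: "trm \<Rightarrow> trm \<Rightarrow> bool" where
  whr_redex: "whr (Abs P \<cdot> Q) (subst P Q 0)"
| whr_app: "whr M M' \<Longrightarrow> whr (M \<cdot> N) (M' \<cdot> N)"

abbreviation whrs :: "trm \<Rightarrow> trm \<Rightarrow> bool" (infix "\<leadsto>" 50) where
  "M \<leadsto> N \<equiv> whr\<^sup>*\<^sup>* M N"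

lemma whrs_trans [trans]: "M \<leadsto> N \<Longrightarrow> N \<leadsto> L \<Longrightarrow> M \<leadsto> L"
  by (rule rtranclp_trans)

lemma redex: "Abs P \<cdot> Q \<leadsto> inst P (senv [Q])"
  using whr_redex[of P Q] by (auto simp: subst_0)

lemma app_left: "M \<leadsto> N \<Longrightarrow> M \<cdot> Q \<leadsto> N \<cdot> Q"
  by (induction rule: rtranclp_induct) (auto intro: rtranclp.rtrancl_into_rtrancl whr_app)

lemma apps_left: "M \<leadsto> N \<Longrightarrow> apps M Qs \<leadsto> apps N Qs"
  by (induction Qs arbitrary: M N) (auto intro: app_left)

lemma whr_inst: "whr M N \<Longrightarrow> whr (inst M \<sigma>) (inst N \<sigma>)"
proof (induction rule: whr.induct)
  case (whr_redex P Q)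
  have "inst (subst P Q 0) \<sigma> = subst (inst P (up \<sigma>)) (inst Q \<sigma>) 0"
    unfolding subst_0 inst_inst
    by (rule arg_cong[of _ _ "inst P"])
      (auto simp: fun_eq_iff senv_def up_def lift_inst_up split: nat.split)
  then show ?case by (simp add: whr.whr_redex)
qed (auto intro: whr_app)

lemma whrs_inst: "M \<leadsto> N \<Longrightarrow> inst M \<sigma> \<leadsto> inst N \<sigma>"
  by (induction rule: rtranclp_induct) (auto intro: rtranclp.rtrancl_into_rtrancl whr_inst)

lemma whrs_Abs: "Abs P \<leadsto> N \<Longrightarrow> N = Abs P"
  by (induction rule: rtranclp_induct) (auto elim: whr.cases)

text \<open>Head reduction cut into weak head reductions, one per exposed abstraction. Weak steps
  are stable under application, unlike head steps below a binder, so arguments can be fed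
  in.\<close>

primrec wlam :: "nat \<Rightarrow> trm \<Rightarrow> trm \<Rightarrow> bool" where
  "wlam 0 M B \<longleftrightarrow> M \<leadsto> B"
| "wlam (Suc n) M B \<longleftrightarrow> (\<exists>P. M \<leadsto> Abs P \<and> wlam n P B)"

lemma wlam_inst: "wlam n M B \<Longrightarrow> wlam n (inst M \<sigma>) (inst B ((up ^^ n) \<sigma>))"
proof (induction n arbitrary: M \<sigma>)
  case 0
  then show ?case by (simp add: whrs_inst)
next
  case (Suc n)
  then obtain P where P: "M \<leadsto> Abs P" "wlam n P B" by auto
  show ?case
    using whrs_inst[OF P(1), of \<sigma>] Suc.IH[OF P(2), of "up \<sigma>"] by (auto simp: funpow_swap1)
qed

lemma wlam_whrs: "M \<leadsto> N \<Longrightarrow> wlam n N B \<Longrightarrow> wlam n M B"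
  by (cases n) (auto intro: rtranclp_trans)

lemma wlam_trans: "wlam n M B \<Longrightarrow> wlam m B C \<Longrightarrow> wlam (n + m) M C"
  by (induction n arbitrary: M) (auto intro: wlam_whrs)

lemma wlam_body: "wlam n M B \<Longrightarrow> B \<leadsto> C \<Longrightarrow> wlam n M C"
  using wlam_trans[of n M B 0 C] by simp

lemma wlam_lams: "wlam n (lams n B) B"
  by (induction n) auto

lemma wlam_app:
  assumes "wlam (Suc n) M B"
  shows "wlam n (M \<cdot> Q) (inst B ((up ^^ n) (senv [Q])))"
proof -
  from assms obtain P where P: "M \<leadsto> Abs P" "wlam n P B" by auto
  have "M \<cdot> Q \<leadsto> inst P (senv [Q])"
    using app_left[OF P(1)] redex by (rule rtranclp_trans)
  then show ?thesis
    using wlam_inst[OF P(2)] by (rule wlam_whrs)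
qed

lemma senv_Cons: "inst (((up ^^ length Xs) (senv [X])) i) (senv Xs) = senv (Xs @ [X]) i"
proof (cases "i < length Xs")
  case True
  then show ?thesis by (simp add: up_funpow_less senv_def nth_append)
next
  case False
  then obtain j where "i = j + length Xs" by (metis add.commute le_Suc_ex not_less)
  then show ?thesis
    by (simp add: up_funpow_add inst_ren senv_def nth_append)
qed


lemma up_inst: "inst (up \<sigma> i) (up \<tau>) = up (\<lambda>i. inst (\<sigma> i) \<tau>) i"
  by (auto simp: up_def lift_inst_up lift_inst split: nat.split)

lemma up_funpow_inst: "inst ((up ^^ d) \<sigma> i) ((up ^^ d) \<tau>) = (up ^^ d) (\<lambda>i. inst (\<sigma> i) \<tau>) i"
  by (induction d arbitrary: i) (simp_all add: up_inst)

text \<open>The arguments use up the outer \<open>length Xs\<close> binders and the \<open>d\<close>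
  others stay, so the substitution acts beneath these. Positive \<open>d\<close> is the case of an
  arity exceeding the number of arguments.\<close>

lemma wlam_apps:
  assumes "wlam (length Xs + d) M B"
  shows "wlam d (apps M Xs) (inst B ((up ^^ d) (senv (rev Xs))))"
  using assms
proof (induction Xs arbitrary: M B)
  case Nil
  have "senv [] = Var" by (auto simp: senv_def fun_eq_iff)
  moreover have "(up ^^ d) Var = Var" by (induction d) (simp_all add: up_Var)
  ultimately show ?case using Nil by simp
next
  case (Cons X Xs)
  have "wlam (length Xs + d) (M \<cdot> X) (inst B ((up ^^ (length Xs + d)) (senv [X])))"
    using Cons.prems by (intro wlam_app) simp
  from Cons.IH[OF this] have 1: "wlam d (apps M (X # Xs))
      (inst B (\<lambda>i. inst ((up ^^ (length Xs + d)) (senv [X]) i) ((up ^^ d) (senv (rev Xs)))))"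
    by (simp add: inst_inst)
  have "(up ^^ (length Xs + d)) (senv [X]) = (up ^^ d) ((up ^^ length Xs) (senv [X]))"
    by (metis add.commute comp_apply funpow_add)
  then have 2: "(\<lambda>i. inst ((up ^^ (length Xs + d)) (senv [X]) i) ((up ^^ d) (senv (rev Xs))))
      = (up ^^ d) (\<lambda>i. inst ((up ^^ length (rev Xs)) (senv [X]) i) (senv (rev Xs)))"
    by (simp add: up_funpow_inst fun_eq_iff)
  have "(\<lambda>i. inst ((up ^^ length (rev Xs)) (senv [X]) i) (senv (rev Xs))) = senv (rev (X # Xs))"
    using senv_Cons[of "rev Xs" X] by (simp add: fun_eq_iff)
  then show ?case using 1 unfolding 2 by simp
qed

lemma lams_apps: "length Xs = n \<Longrightarrow> apps (lams n B) Xs \<leadsto> inst B (senv (rev Xs))"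
  using wlam_apps[of Xs 0 "lams n B" B] wlam_lams[of n B] by simp

section \<open>Weak head reduction and Boehm trees\<close>

lemma whr_head_red:
  assumes "whr M N"
  shows "head_red (lams n M) (lams n N)"
proof -
  from assms have "\<exists>P Q Ns. M = apps (Abs P \<cdot> Q) Ns \<and> N = apps (subst P Q 0) Ns"
  proof (induction rule: whr.induct)
    case (whr_redex P Q)
    show ?case by (intro exI[of _ P] exI[of _ Q] exI[of _ "[]"]) simp
  next
    case (whr_app M M' N)
    then obtain P Q Ns where "M = apps (Abs P \<cdot> Q) Ns" "M' = apps (subst P Q 0) Ns" by blast
    then show ?case by (intro exI[of _ P] exI[of _ Q] exI[of _ "Ns @ [N]"]) simp
  qed
  then show ?thesis by (auto intro: head_red.intros)
qed

lemma whrs_head_red: "M \<leadsto> N \<Longrightarrow> head_red\<^sup>*\<^sup>* (lams n M) (lams n N)"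
  by (induction rule: rtranclp_induct) (auto intro: rtranclp.rtrancl_into_rtrancl whr_head_red)

lemma wlam_head_red: "wlam n M B \<Longrightarrow> head_red\<^sup>*\<^sup>* (lams m M) (lams (m + n) B)"
proof (induction n arbitrary: M m)
  case 0
  then show ?case by (simp add: whrs_head_red)
next
  case (Suc n)
  then obtain P where P: "M \<leadsto> Abs P" "wlam n P B" by auto
  show ?case
    using whrs_head_red[OF P(1), of m] Suc.IH[OF P(2), of "Suc m"]
    by (simp add: funpow_swap1)
qed

text \<open>For \<open>n\<close> below \<open>m\<close>, \<open>B\<close> would be an abstraction
  that still contains \<open>N\<close>; the last hypothesis excludes this.\<close>

lemma wlam_lams_expand:
  assumes "wlam n (lams m N) B" "whr M N" "\<forall>u. B \<noteq> Abs u"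
  shows "wlam n (lams m M) B"
  using assms(1)
proof (induction m arbitrary: n)
  case 0
  then show ?case using assms(2) by (auto intro: wlam_whrs)
next
  case (Suc m)
  then show ?case using assms(3) by (cases n) (auto dest: whrs_Abs)
qed

lemma whr_apps: "whr M N \<Longrightarrow> whr (apps M Qs) (apps N Qs)"
  by (induction Qs arbitrary: M N) (auto intro: whr_app)

lemma wlam_iff_head_red: "wlam n M (apps (Var y) Ns) \<longleftrightarrow> head_red\<^sup>*\<^sup>* M (hnf (n, y, Ns))"
proof
  assume "wlam n M (apps (Var y) Ns)"
  from wlam_head_red[OF this, of 0] show "head_red\<^sup>*\<^sup>* M (hnf (n, y, Ns))"
    by (simp add: hnf_def)
next
  assume "head_red\<^sup>*\<^sup>* M (hnf (n, y, Ns))"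
  then show "wlam n M (apps (Var y) Ns)"
  proof (induction rule: converse_rtranclp_induct)
    case base
    show ?case by (simp add: hnf_def wlam_lams)
  next
    case (step M N)
    from step.hyps(1) obtain m P Q Qs where
      M: "M = lams m (apps (Abs P \<cdot> Q) Qs)" "N = lams m (apps (subst P Q 0) Qs)"
      by (rule head_red.cases)
    show ?case
      using step.IH unfolding M
      by (rule wlam_lams_expand) (simp_all add: whr_apps whr_redex apps_not_Abs)
  qed
qed

lemma BT_wlam: "wlam n M (apps (Var y) Ns) \<Longrightarrow> BT M = Node n y (map BT Ns)"
  by (simp add: wlam_iff_head_red BT_hnf)

lemma BT_Node_wlam:
  assumes "BT M = Node n y Ts"
  obtains Ns where "wlam n M (apps (Var y) Ns)" "map BT Ns = Ts"
proof (cases "\<exists>h. head_red\<^sup>*\<^sup>* M (hnf h)")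
  case True
  then obtain m z Ns where h: "head_red\<^sup>*\<^sup>* M (hnf (m, z, Ns))" by auto
  with assms have "m = n" "z = y" "map BT Ns = Ts" by (auto dest: BT_hnf)
  with h that show ?thesis by (simp add: wlam_iff_head_red)
next
  case False
  with assms show ?thesis using BT_Bot[of M] by simp
qed

section \<open>Permutation trees\<close>

type_synonym ptree = "nat list \<Rightarrow> nat \<times> (nat \<Rightarrow> nat)"

abbreviation arity :: "ptree \<Rightarrow> nat" where "arity p \<equiv> fst (p [])"
abbreviation perm :: "ptree \<Rightarrow> nat \<Rightarrow> nat" where "perm p \<equiv> snd (p [])"

definition child :: "ptree \<Rightarrow> nat \<Rightarrow> ptree" where
  "child p i = (\<lambda>w. p (i # w))"

definition triv :: ptree where
  "triv = (\<lambda>w. (0, id))"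

text \<open>Padding by \<open>triv\<close>, the tree of a single variable, and by the identity lets
  trees of different arities be composed without case distinctions.\<close>

coinductive good :: "ptree \<Rightarrow> bool" where
  "perm p permutes {..<arity p} \<Longrightarrow> \<forall>i\<ge>arity p. child p i = triv \<Longrightarrow> \<forall>i. good (child p i) \<Longrightarrow> good p"

lemma child_triv [simp]: "child triv i = triv"
  by (simp add: child_def triv_def)

lemma triv_Nil [simp]: "triv [] = (0, id)"
  by (simp add: triv_def)

lemma good_triv: "good triv"
  by (coinduction) (simp add: permutes_id)

lemma goodD:
  assumes "good p"
  shows "perm p permutes {..<arity p}" "arity p \<le> i \<Longrightarrow> child p i = triv" "good (child p i)"
  using assms by (auto elim: good.cases)

lemma good_perm:
  assumes "good p"
  shows "perm p i < arity p \<longleftrightarrow> i < arity p" "arity p \<le> i \<Longrightarrow> perm p i = i" "bij (perm p)"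
    "arity p \<le> L \<Longrightarrow> perm p i < L \<longleftrightarrow> i < L"
proof -
  note p = goodD(1)[OF assms]
  show 1: "perm p i < arity p \<longleftrightarrow> i < arity p" using permutes_in_image[OF p, of i] by simp
  show 2: "arity p \<le> i \<Longrightarrow> perm p i = i" using permutes_not_in[OF p, of i] by simp
  show "bij (perm p)" using p by (rule permutes_bij)
  show "arity p \<le> L \<Longrightarrow> perm p i < L \<longleftrightarrow> i < L"
    using 1 2 by (metis leI order_less_le_trans)
qed

text \<open>The data of \<open>P \<circ> Q\<close>. The two factors are interchanged at each level because
  \<open>P (Q x) = \<lambda>x\<^sub>1\<dots>x\<^sub>n. Q x P\<^sub>1\<dots>P\<^sub>n\<close>, so that \<open>Q\<^sub>j\<close> takes \<open>P\<^bsub>\<sigma> j\<^esub>\<close> as its argument.\<close>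

primrec pcomp :: "ptree \<Rightarrow> ptree \<Rightarrow> ptree" where
  "pcomp p q [] = (max (arity p) (arity q), perm p \<circ> perm q)"
| "pcomp p q (j # w) = pcomp (child q j) (child p (perm q j)) w"

text \<open>The child is chosen such that child \<open>j\<close> of \<open>pcomp p (pinv p)\<close>
  is \<open>pcomp (pinv r) r\<close>, where \<open>r\<close> is the child of \<open>p\<close> at the
  preimage of \<open>j\<close>.\<close>

primrec pinv :: "ptree \<Rightarrow> ptree" where
  "pinv p [] = (arity p, inv_into UNIV (perm p))"
| "pinv p (j # w) = pinv (child p (inv_into UNIV (perm p) j)) w"

lemma child_pcomp [simp]: "child (pcomp p q) j = pcomp (child q j) (child p (perm q j))"
  by (auto simp: child_def)

lemma child_pinv [simp]: "child (pinv p) j = pinv (child p (inv_into UNIV (perm p) j))"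
  by (auto simp: child_def)

text \<open>Bisimulation for trees given as functions on positions, by induction on the
  position.\<close>

lemma ptree_eqI:
  assumes "R p q"
    and "\<And>p q. R p q \<Longrightarrow> p [] = q [] \<and> (\<forall>j. R (child p j) (child q j))"
  shows "p = q"
proof
  fix w
  show "p w = q w"
    using assms(1)
  proof (induction w arbitrary: p q)
    case (Cons j w)
    then have "child p j w = child q j w" using assms(2) by blast
    then show ?case by (simp add: child_def)
  qed (use assms(2) in blast)
qed

lemma pcomp_triv_triv [simp]: "pcomp triv triv = triv"
  by (rule ptree_eqI[where R = "\<lambda>p q. p = pcomp triv triv \<and> q = triv"]) auto

lemma pcomp_triv:
  "pcomp triv p = p" "pcomp p triv = p"
proof -
  let ?R = "\<lambda>p q. p = pcomp triv q \<or> p = pcomp q triv"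
  show "pcomp triv p = p" by (rule ptree_eqI[where R = ?R]) auto
  show "pcomp p triv = p" by (rule ptree_eqI[where R = ?R]) auto
qed

lemma good_pcomp: "good p \<Longrightarrow> good q \<Longrightarrow> good (pcomp p q)"
proof (coinduction arbitrary: p q)
  case good
  have "perm p permutes {..<max (arity p) (arity q)}" "perm q permutes {..<max (arity p) (arity q)}"
    using goodD(1)[OF good(1)] goodD(1)[OF good(2)] by (auto elim!: permutes_subset)
  then have "perm p \<circ> perm q permutes {..<max (arity p) (arity q)}"
    by (rule permutes_compose[rotated])
  moreover have "\<forall>i\<ge>max (arity p) (arity q). child (pcomp p q) i = triv"
    using good by (auto simp: goodD(2) good_perm(2))
  ultimately show ?case
    using good goodD(3) by simp blast
qed

lemma good_pinv: "good p \<Longrightarrow> good (pinv p)"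
proof (coinduction arbitrary: p)
  case good
  have p: "inv_into UNIV (perm p) permutes {..<arity p}"
    using goodD(1)[OF good] by (rule permutes_inv)
  have "pinv triv = triv"
    by (rule ptree_eqI[where R = "\<lambda>p q. p = pinv triv \<and> q = triv"]) auto
  then have "\<forall>i\<ge>arity p. child (pinv p) i = triv"
    using goodD(2)[OF good] permutes_not_in[OF p] by auto
  with p show ?case
    using goodD(3)[OF good] by simp blast
qed

lemma good_inv_perm:
  assumes "good p"
  shows "perm p (inv_into UNIV (perm p) i) = i" "inv_into UNIV (perm p) (perm p i) = i"
  using good_perm(3)[OF assms]
  by (simp_all add: bij_is_surj surj_f_inv_f bij_is_inj inv_f_f)

lemma pinv_pinv: "good p \<Longrightarrow> pinv (pinv p) = p"
  by (rule ptree_eqI[where R = "\<lambda>p q. good q \<and> p = pinv (pinv q)"])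
    (auto simp: goodD(3) good_inv_perm inv_inv_eq[OF good_perm(3)] prod_eq_iff)

text \<open>The factors change sides at each level, so passing to a child turns either bracketing
  into the other; a single bisimulation has to contain both.\<close>

lemma pcomp_pinv_pcomp:
  assumes "good p"
  shows "pcomp (pcomp p (pinv p)) p = p" "pcomp p (pcomp (pinv p) p) = p"
proof -
  let ?R = "\<lambda>p q. good q \<and> (p = pcomp (pcomp q (pinv q)) q \<or> p = pcomp q (pcomp (pinv q) q))"
  have step: "p [] = q [] \<and> (\<forall>j. ?R (child p j) (child q j))" if "?R p q" for p q
    using that by (auto simp: goodD(3) good_inv_perm prod_eq_iff comp_def)
  show "pcomp (pcomp p (pinv p)) p = p"
    using assms by (intro ptree_eqI[where R = ?R, OF _ step]) auto
  show "pcomp p (pcomp (pinv p) p) = p"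
    using assms by (intro ptree_eqI[where R = ?R, OF _ step]) auto
qed

text \<open>Among good trees, these belong to the finite or infinite eta-expansions of the
  identity.\<close>

definition pdiag :: "ptree \<Rightarrow> bool" where
  "pdiag p \<longleftrightarrow> (\<forall>w. snd (p w) = id)"

lemma pdiag_perm: "pdiag p \<Longrightarrow> perm p = id"
  and pdiag_child: "pdiag p \<Longrightarrow> pdiag (child p j)"
  by (simp_all add: pdiag_def child_def)

lemma pcomp_pdiag_commute: "pdiag p \<Longrightarrow> pdiag q \<Longrightarrow> pcomp p q = pcomp q p"
  by (rule ptree_eqI[where R = "\<lambda>r s. \<exists>p q. pdiag p \<and> pdiag q \<and> r = pcomp p q \<and> s = pcomp q p"])
    (auto simp: pdiag_perm max.commute, metis pdiag_child)

lemma pcomp_pdiag_idem: "pdiag p \<Longrightarrow> pcomp p p = p"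
  by (rule ptree_eqI[where R = "\<lambda>r p. pdiag p \<and> r = pcomp p p"])
    (auto simp: pdiag_perm prod_eq_iff intro: pdiag_child)

text \<open>An idempotent permutation is the identity. The hypothesis ignores arities because
  separation modulo a theory yields only the permutations.\<close>

lemma pdiag_if_idem:
  assumes "good p" "\<forall>w. snd (pcomp p p w) = snd (p w)"
  shows "pdiag p"
proof -
  have "snd (p w) = id" for w
    using assms
  proof (induction w arbitrary: p)
    case Nil
    then have 1: "perm p \<circ> perm p = perm p" by (metis pcomp.simps(1) snd_conv)
    show ?case
    proof
      fix i
      show "perm p i = id i"
        using good_inv_perm(2)[OF Nil(1), of i] good_inv_perm(2)[OF Nil(1), of "perm p i"]
          fun_cong[OF 1, of i] by simp
    qed
  next
    case (Cons j w)
    have 1: "perm p \<circ> perm p = perm p" using Cons.prems(2) by (metis pcomp.simps(1) snd_conv)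
    have "perm p j = j"
      using good_inv_perm(2)[OF Cons.prems(1), of j] good_inv_perm(2)[OF Cons.prems(1), of "perm p j"]
        fun_cong[OF 1, of j] by simp
    then have "snd (pcomp (child p j) (child p j) v) = snd (child p j v)" for v
      using Cons.prems(2)[rule_format, of "j # v"] by (simp add: child_def)
    then show ?case
      using Cons.IH[of "child p j"] goodD(3)[OF Cons.prems(1)] by (simp add: child_def)
  qed
  then show ?thesis by (simp add: pdiag_def)
qed

text \<open>The disjunction makes the induction go through: \<open>q\<close> changes sides in the
  composition from each level to the next.\<close>

lemma pdiag_cancel:
  assumes "pdiag p" "pdiag (pcomp p q) \<or> pdiag (pcomp q p)"
  shows "pdiag q"
proof -
  have "snd (q w) = id" for w
    using assms
  proof (induction w arbitrary: p q)
    case Nil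
    then show ?case using pdiag_perm[of p] pdiag_perm[of "pcomp p q"] pdiag_perm[of "pcomp q p"] by auto
  next
    case (Cons j w)
    have "perm q = id"
      using Cons.prems pdiag_perm[of p] pdiag_perm[of "pcomp p q"] pdiag_perm[of "pcomp q p"] by auto
    with Cons.prems pdiag_perm[of p] have "pdiag (pcomp (child q j) (child p j)) \<or> pdiag (pcomp (child p j) (child q j))"
      using pdiag_child[of "pcomp p q" j] pdiag_child[of "pcomp q p" j] by auto
    then have "snd (child q j w) = id"
      using Cons.IH[of "child p j" "child q j"] pdiag_child[OF Cons.prems(1)] by blast
    then show ?case by (simp add: child_def)
  qed
  then show ?thesis by (simp add: pdiag_def)
qed

section \<open>Terms represented by permutation trees\<close>

text \<open>\<open>rep p k M\<close> says that the Boehm tree of \<open>M\<close> belongs to \<open>HP(x)\<close>, where \<open>x\<close> is the variable of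
  index \<open>k\<close>, with the arities and permutations given by \<open>p\<close>.\<close>

coinductive rep :: "ptree \<Rightarrow> nat \<Rightarrow> trm \<Rightarrow> bool" where
  "\<lbrakk>wlam (arity p) M (apps (Var (arity p + k)) Ms); length Ms = arity p;
    \<forall>i<arity p. rep (child p i) (arity p - Suc (perm p i)) (Ms ! i)\<rbrakk> \<Longrightarrow> rep p k M"

lemma repE:
  assumes "rep p k M"
  obtains Ms where "wlam (arity p) M (apps (Var (arity p + k)) Ms)" "length Ms = arity p"
    "\<And>i. i < arity p \<Longrightarrow> rep (child p i) (arity p - Suc (perm p i)) (Ms ! i)"
  using assms by (auto elim: rep.cases)

lemma rep_triv: "M \<leadsto> Var k \<Longrightarrow> rep triv k M"
  by (rule rep.intros[of _ _ _ "[]"]) simp_all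

lemma rep_whrs: "M \<leadsto> N \<Longrightarrow> rep p k N \<Longrightarrow> rep p k M"
  by (erule repE) (auto intro: rep.intros wlam_whrs)

text \<open>Only the value at \<open>k\<close> matters: other variables of \<open>M\<close> below
  which no binder intervenes never reach a head position of the tree.\<close>

lemma rep_rename:
  assumes "good p" "rep p k M" "\<sigma> k = Var k'"
  shows "rep p k' (inst M \<sigma>)"
  using assms
proof (coinduction arbitrary: p k M \<sigma> k')
  case rep
  let ?n = "arity p"
  from rep(2) obtain Ms where Ms: "wlam ?n M (apps (Var (?n + k)) Ms)" "length Ms = ?n"
    "\<And>i. i < ?n \<Longrightarrow> rep (child p i) (?n - Suc (perm p i)) (Ms ! i)"
    by (rule repE) blast
  let ?\<sigma> = "(up ^^ ?n) \<sigma>"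
  have "?\<sigma> (?n + k) = Var (?n + k')"
    using up_funpow_add[of ?n \<sigma> k] rep(3) by (simp add: add.commute)
  then have "wlam ?n (inst M \<sigma>) (apps (Var (?n + k')) (map (\<lambda>N. inst N ?\<sigma>) Ms))"
    using wlam_inst[OF Ms(1), of \<sigma>] by simp
  moreover have "?\<sigma> (?n - Suc (perm p i)) = Var (?n - Suc (perm p i))" if "i < ?n" for i
    using that by (intro up_funpow_less) simp
  ultimately show ?case
    using Ms(2,3) goodD(3)[OF rep(1)]
    by (intro exI[of _ p] exI[of _ "inst M \<sigma>"] exI[of _ k'] exI[of _ "map (\<lambda>N. inst N ?\<sigma>) Ms"])
      fastforce
qed

lemma rep_BT:
  assumes "rep p k M"
  obtains Ms where "BT M = Node (arity p) (arity p + k) (map BT Ms)" "length Ms = arity p"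
    "\<And>i. i < arity p \<Longrightarrow> rep (child p i) (arity p - Suc (perm p i)) (Ms ! i)"
  using assms by (metis repE BT_wlam)

lemma rep_unique:
  assumes "rep p k M" "rep p k N"
  shows "BT M = BT N"
proof -
  have "A = B" if "\<exists>p k M N. A = BT M \<and> B = BT N \<and> rep p k M \<and> rep p k N" for A B
    using that
  proof (coinduction arbitrary: A B rule: btree.coinduct_strong)
    case (Eq_btree A B)
    then obtain p k M N where *: "A = BT M" "B = BT N" "rep p k M" "rep p k N" by blast
    from *(3) obtain Ms where M: "BT M = Node (arity p) (arity p + k) (map BT Ms)"
      "length Ms = arity p"
      "\<And>i. i < arity p \<Longrightarrow> rep (child p i) (arity p - Suc (perm p i)) (Ms ! i)"
      by (rule rep_BT) blast
    from *(4) obtain Ns where N: "BT N = Node (arity p) (arity p + k) (map BT Ns)"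
      "length Ns = arity p"
      "\<And>i. i < arity p \<Longrightarrow> rep (child p i) (arity p - Suc (perm p i)) (Ns ! i)"
      by (rule rep_BT) blast
    show ?case
      unfolding *(1,2) M(1) N(1)
      by (auto simp: list_all2_conv_all_nth M(2) N(2)) (use M(3) N(3) in blast)
  qed
  with assms show ?thesis by blast
qed

lemma rep_HP_tree_at:
  assumes "good p" "rep p k M"
  shows "HP_tree_at k (BT M)"
  using assms
proof (coinduction arbitrary: p k M)
  case HP_tree_at
  from HP_tree_at(2) obtain Ms where M: "BT M = Node (arity p) (arity p + k) (map BT Ms)"
    "length Ms = arity p"
    "\<And>i. i < arity p \<Longrightarrow> rep (child p i) (arity p - Suc (perm p i)) (Ms ! i)"
    by (rule rep_BT) blast
  show ?case
    using goodD(1,3)[OF HP_tree_at(1)] M by (auto intro!: exI[of _ "perm p"])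
qed

text \<open>\<open>HP_tree_at\<close> merely asserts that a permutation exists at each node, so one
  is chosen; positions outside the tree get the values of \<open>triv\<close>.\<close>

primrec ptree_of :: "nat list \<Rightarrow> btree \<Rightarrow> nat \<times> (nat \<Rightarrow> nat)" where
  "ptree_of [] A = (case A of Bot \<Rightarrow> (0, id) | Node n y Ts \<Rightarrow>
    (n, SOME \<pi>. \<pi> permutes {..<n} \<and> (\<forall>i<n. HP_tree_at (n - Suc (\<pi> i)) (Ts ! i))))"
| "ptree_of (j # w) A = (case A of Bot \<Rightarrow> (0, id) | Node n y Ts \<Rightarrow>
    if j < n then ptree_of w (Ts ! j) else (0, id))"

abbreviation "btp A \<equiv> (\<lambda>w. ptree_of w A)"

lemma btp_HP:
  assumes "HP_tree_at k A"
  obtains Ts where "A = Node (arity (btp A)) (arity (btp A) + k) Ts" "length Ts = arity (btp A)"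
    "perm (btp A) permutes {..<arity (btp A)}"
    "\<And>i. i < arity (btp A) \<Longrightarrow> child (btp A) i = btp (Ts ! i)"
    "\<And>i. i < arity (btp A) \<Longrightarrow> HP_tree_at (arity (btp A) - Suc (perm (btp A) i)) (Ts ! i)"
    "\<And>i. arity (btp A) \<le> i \<Longrightarrow> child (btp A) i = triv"
proof -
  from assms obtain n \<pi> Ts where A: "A = Node n (n + k) Ts" "length Ts = n"
    and \<pi>: "\<pi> permutes {..<n}" "\<forall>i<n. HP_tree_at (n - Suc (\<pi> i)) (Ts ! i)"
    by (auto elim: HP_tree_at.cases)
  let ?P = "\<lambda>\<pi>. \<pi> permutes {..<n} \<and> (\<forall>i<n. HP_tree_at (n - Suc (\<pi> i)) (Ts ! i))"
  have "?P (Eps ?P)" by (rule someI[of ?P \<pi>]) (use \<pi> in blast)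
  moreover have "perm (btp A) = Eps ?P" "arity (btp A) = n" using A by simp_all
  ultimately show ?thesis
    using A by (intro that[of Ts]) (auto simp: child_def triv_def)
qed

lemma good_btp:
  assumes "HP_tree_at k A"
  shows "good (btp A)"
proof -
  have "good p" if "p = triv \<or> (\<exists>k A. p = btp A \<and> HP_tree_at k A)" for p
    using that
  proof (coinduction arbitrary: p)
    case (good p)
    then show ?case
    proof (elim disjE exE conjE)
      assume "p = triv"
      then show ?thesis by (simp add: permutes_id)
    next
      fix k A assume p: "p = btp A" "HP_tree_at k A"
      from p(2) obtain Ts where "perm p permutes {..<arity p}"
        "\<And>i. i < arity p \<Longrightarrow> child p i = btp (Ts ! i)"
        "\<And>i. i < arity p \<Longrightarrow> HP_tree_at (arity p - Suc (perm p i)) (Ts ! i)"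
        "\<And>i. arity p \<le> i \<Longrightarrow> child p i = triv"
        unfolding p(1) by (rule btp_HP) blast
      then show ?thesis by (metis leI)
    qed
  qed
  with assms show ?thesis by blast
qed

lemma rep_btp:
  assumes "HP_tree_at k (BT M)"
  shows "rep (btp (BT M)) k M"
  using assms
proof (coinduction arbitrary: k M)
  case rep
  let ?p = "btp (BT M)"
  from rep obtain Ts where Ts: "BT M = Node (arity ?p) (arity ?p + k) Ts" "length Ts = arity ?p"
    "\<And>i. i < arity ?p \<Longrightarrow> child ?p i = btp (Ts ! i)"
    "\<And>i. i < arity ?p \<Longrightarrow> HP_tree_at (arity ?p - Suc (perm ?p i)) (Ts ! i)"
    by (rule btp_HP) blast
  from Ts(1) obtain Ms where Ms: "wlam (arity ?p) M (apps (Var (arity ?p + k)) Ms)" "map BT Ms = Ts"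
    by (rule BT_Node_wlam)
  then have "length Ms = arity ?p" "\<And>i. i < arity ?p \<Longrightarrow> Ts ! i = BT (Ms ! i)"
    using Ts(2) by auto
  then show ?case
    using Ms(1) Ts(3,4)
    by (intro exI[of _ ?p] exI[of _ M] exI[of _ k] exI[of _ Ms]) auto
qed

definition Rep :: "ptree \<Rightarrow> trm \<Rightarrow> bool" where
  "Rep p M \<longleftrightarrow> good p \<and> (\<exists>P. M \<leadsto> Abs P \<and> rep p 0 P)"

lemma Rep_BT:
  assumes "M \<leadsto> Abs P" "rep p k P"
  shows "BT M = bt_abs (BT P)"
proof -
  from assms(2) obtain Ms where P: "wlam (arity p) P (apps (Var (arity p + k)) Ms)"
    by (rule repE) blast
  with assms(1) have "wlam (Suc (arity p)) M (apps (Var (arity p + k)) Ms)" by auto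
  from BT_wlam[OF P] BT_wlam[OF this] show ?thesis by (simp add: bt_abs_def)
qed

lemma Rep_unique: "Rep p M \<Longrightarrow> Rep p N \<Longrightarrow> BT M = BT N"
  unfolding Rep_def by (metis Rep_BT rep_unique)

lemma HP_iff_Rep: "M \<in> HP \<longleftrightarrow> (\<exists>p. Rep p M)"
proof
  assume "\<exists>p. Rep p M"
  then show "M \<in> HP"
    unfolding Rep_def HP_def HP_tree_def by (auto simp: Rep_BT intro: rep_HP_tree_at)
next
  assume "M \<in> HP"
  then obtain A where A: "BT M = bt_abs A" "HP_tree_at 0 A"
    by (auto simp: HP_def HP_tree_def)
  then obtain n Ts where A': "A = Node n n Ts" by (auto elim: HP_tree_at.cases)
  with A(1) have "BT M = Node (Suc n) n Ts" by (simp add: bt_abs_def)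
  then obtain Ms where "wlam (Suc n) M (apps (Var n) Ms)" "map BT Ms = Ts" by (rule BT_Node_wlam)
  then obtain P where P: "M \<leadsto> Abs P" "wlam n P (apps (Var n) Ms)" by auto
  then have "BT P = A" using A' \<open>map BT Ms = Ts\<close> by (simp add: BT_wlam)
  with A(2) P(1) have "Rep (btp A) M"
    using rep_btp[of 0 P] good_btp by (auto simp: Rep_def)
  then show "\<exists>p. Rep p M" by blast
qed

lemma Rep_I: "Rep triv I_trm"
  unfolding Rep_def I_trm_def using good_triv rep_triv by blast

text \<open>Substitution puts a term of tree \<open>q\<close> at the head of \<open>M\<close>. Its
  \<open>i\<close>-th child then receives the argument number \<open>perm q i\<close> of
  \<open>M\<close> for its own head variable, which is the same situation with the factors
  interchanged. Leaving \<open>\<sigma>\<close> free except at \<open>k\<close> allows this to be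
  the coinduction hypothesis.\<close>

lemma rep_pcomp:
  assumes "good p" "good q" "rep p k M" "rep q k' (\<sigma> k)"
  shows "rep (pcomp p q) k' (inst M \<sigma>)"
proof -
  have "rep r k' X" if "\<exists>p q k M \<sigma>. good p \<and> good q \<and> rep p k M \<and> rep q k' (\<sigma> k) \<and> r = pcomp p q \<and>
      X = inst M \<sigma>" for r k' X
    using that
  proof (coinduction arbitrary: r k' X rule: rep.coinduct)
    case (rep r k' X)
    then obtain p q k M \<sigma> where p: "good p" and q: "good q" and M: "rep p k M"
      and Q: "rep q k' (\<sigma> k)" and r: "r = pcomp p q" and X: "X = inst M \<sigma>" by blast
    let ?n = "arity p" and ?m = "arity q"
    let ?R = "\<lambda>r k' X. \<exists>p q k M \<sigma>. good p \<and> good q \<and> rep p k M \<and> rep q k' (\<sigma> k) \<and>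
      r = pcomp p q \<and> X = inst M \<sigma>"
    from M obtain Ms where Ms: "wlam ?n M (apps (Var (?n + k)) Ms)" "length Ms = ?n"
      "\<And>i. i < ?n \<Longrightarrow> rep (child p i) (?n - Suc (perm p i)) (Ms ! i)"
      by (rule repE) blast
    define Xs where "Xs = map (\<lambda>N. inst N ((up ^^ ?n) \<sigma>)) Ms"
    have lenXs: "length Xs = ?n" by (simp add: Xs_def Ms(2))
    have Xs: "rep (child p i) (?n - Suc (perm p i)) (Xs ! i)" if "i < ?n" for i
    proof -
      have "?n - Suc (perm p i) < ?n" using that by simp
      then show ?thesis
        using rep_rename[OF goodD(3)[OF p] Ms(3)[OF that]] that
        by (simp add: Xs_def Ms(2) up_funpow_less)
    qed
    \<comment> \<open>Below the \<open>arity p\<close> binders of \<open>X\<close>, the term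
      replacing the head variable appears shifted.\<close>
    define Q' where "Q' = inst (\<sigma> k) (\<lambda>j. Var (j + ?n))"
    have wX: "wlam ?n X (apps Q' Xs)"
      using wlam_inst[OF Ms(1), of \<sigma>] up_funpow_add[of ?n \<sigma> k]
      by (simp add: Xs_def X Q'_def add.commute)
    have "rep q (k' + ?n) Q'"
      unfolding Q'_def by (rule rep_rename[OF q Q]) simp
    then obtain Qs where Qs: "wlam ?m Q' (apps (Var (?m + (k' + ?n))) Qs)" "length Qs = ?m"
      "\<And>i. i < ?m \<Longrightarrow> rep (child q i) (?m - Suc (perm q i)) (Qs ! i)"
      by (rule repE) blast
    have stepI: ?case
      if "wlam (arity r) X (apps (Var (arity r + k')) Zs)" "length Zs = arity r"
        "\<And>i. i < arity r \<Longrightarrow> ?R (child r i) (arity r - Suc (perm r i)) (Zs ! i)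
          \<or> rep (child r i) (arity r - Suc (perm r i)) (Zs ! i)" for Zs
      using that by (intro exI[of _ r] exI[of _ X] exI[of _ k'] exI[of _ Zs]) simp
    show ?case
    proof (cases "?m \<le> ?n")
      case True
      let ?\<tau> = "senv (rev (take ?m Xs))"
      have len: "length (take ?m Xs) = ?m" using True lenXs by simp
      have "apps Q' (take ?m Xs) \<leadsto> inst (apps (Var (?m + (k' + ?n))) Qs) ?\<tau>"
        using wlam_apps[of "take ?m Xs" 0 Q' "apps (Var (?m + (k' + ?n))) Qs"] Qs(1)
        unfolding len by simp
      moreover have "?\<tau> (?m + (k' + ?n)) = Var (?n + k')"
        using len by (simp add: senv_def)
      ultimately have "apps (apps Q' (take ?m Xs)) (drop ?m Xs)
          \<leadsto> apps (apps (Var (?n + k')) (map (\<lambda>N. inst N ?\<tau>) Qs)) (drop ?m Xs)"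
        by (intro apps_left) simp
      then have "apps Q' Xs \<leadsto> apps (Var (?n + k')) (map (\<lambda>N. inst N ?\<tau>) Qs @ drop ?m Xs)"
        by (simp flip: foldl_append)
      with wX have "wlam (arity r) X (apps (Var (arity r + k')) (map (\<lambda>N. inst N ?\<tau>) Qs @ drop ?m Xs))"
        using True by (simp add: r wlam_body)
      moreover have "length (map (\<lambda>N. inst N ?\<tau>) Qs @ drop ?m Xs) = arity r"
        using True by (simp add: r lenXs Qs(2))
      moreover have "?R (child r i) (arity r - Suc (perm r i)) ((map (\<lambda>N. inst N ?\<tau>) Qs @ drop ?m Xs) ! i)
          \<or> rep (child r i) (arity r - Suc (perm r i)) ((map (\<lambda>N. inst N ?\<tau>) Qs @ drop ?m Xs) ! i)"
        if "i < arity r" for i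
      proof (cases "i < ?m")
        case i: True
        have j: "perm q i < ?m" using good_perm(1)[OF q] i by simp
        have "?\<tau> (?m - Suc (perm q i)) = Xs ! (perm q i)"
          using j True by (simp add: senv_def lenXs rev_nth)
        moreover have "rep (child p (perm q i)) (?n - Suc (perm p (perm q i))) (Xs ! (perm q i))"
          using j True by (intro Xs) simp
        ultimately have "?R (pcomp (child q i) (child p (perm q i)))
            (?n - Suc (perm p (perm q i))) (inst (Qs ! i) ?\<tau>)"
          using Qs(3)[OF i] goodD(3)[OF p] goodD(3)[OF q] by metis
        then show ?thesis using i True by (simp add: r nth_append Qs(2) max_def)
      next
        \<comment> \<open>Surplus arguments pass through unchanged, in agreement with the padding of
          \<open>q\<close>.\<close>
        case i: False
        then have "perm q i = i" "child q i = triv"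
          using good_perm(2)[OF q] goodD(2)[OF q] by simp_all
        then show ?thesis
          using i True that Xs[of i] by (simp add: r nth_append Qs(2) max_def pcomp_triv lenXs)
      qed
      ultimately show ?thesis by - (rule stepI, assumption, assumption, blast)
    next
      case False
      then obtain d where d: "?m = ?n + d" by (metis le_Suc_ex linorder_le_cases)
      let ?\<tau> = "(up ^^ d) (senv (rev Xs))"
      have "wlam d (apps Q' Xs) (inst (apps (Var (?m + (k' + ?n))) Qs) ?\<tau>)"
        using wlam_apps[of Xs d Q' "apps (Var (?m + (k' + ?n))) Qs"] Qs(1) by (simp add: lenXs d)
      moreover have "?\<tau> (?m + (k' + ?n)) = Var (?m + k')"
        using up_funpow_add[of d "senv (rev Xs)" "?n + (k' + ?n)"]
        by (simp add: d senv_def lenXs ac_simps)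
      ultimately have "wlam (arity r) X (apps (Var (arity r + k')) (map (\<lambda>N. inst N ?\<tau>) Qs))"
        using wlam_trans[OF wX, of d] by (simp add: r d max_def)
      moreover have "length (map (\<lambda>N. inst N ?\<tau>) Qs) = arity r"
        using False by (simp add: r Qs(2))
      moreover have "?R (child r i) (arity r - Suc (perm r i)) (map (\<lambda>N. inst N ?\<tau>) Qs ! i)"
        if "i < arity r" for i
      proof -
        have i: "i < ?m" using that False by (simp add: r)
        define j where "j = perm q i"
        have j: "j < ?m" using good_perm(1)[OF q] i by (simp add: j_def)
        have "rep (child p j) (?m - Suc (perm p j)) (?\<tau> (?m - Suc j))"
        proof (cases "j < ?n")
          case True
          have pj: "perm p j < ?n" using True good_perm(1)[OF p] by simp
          have "?\<tau> (?m - Suc j) = inst (Xs ! j) (\<lambda>i. Var (i + d))"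
            using up_funpow_add[of d "senv (rev Xs)" "?n - Suc j"] True
            by (simp add: d senv_def lenXs rev_nth)
          moreover have "rep (child p j) (?m - Suc (perm p j)) (inst (Xs ! j) (\<lambda>i. Var (i + d)))"
            by (rule rep_rename[OF goodD(3)[OF p] Xs[OF True]]) (use pj d in simp)
          ultimately show ?thesis by simp
        next
          \<comment> \<open>Here \<open>q\<close> has more binders than there are arguments: binder
            \<open>j\<close> keeps its own variable, in agreement with the padding of
            \<open>p\<close>.\<close>
          case False
          then have "perm p j = j" "child p j = triv"
            using good_perm(2)[OF p] goodD(2)[OF p] by simp_all
          moreover have "?\<tau> (?m - Suc j) = Var (?m - Suc j)"
            using False j d by (intro up_funpow_less) simp
          ultimately show ?thesis by (simp add: rep_triv)
        qed
        then have "?R (pcomp (child q i) (child p j)) (?m - Suc (perm p j)) (inst (Qs ! i) ?\<tau>)"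
          using Qs(3)[OF i] goodD(3)[OF p] goodD(3)[OF q] by (metis j_def)
        then show ?thesis using i False by (simp add: r Qs(2) max_def j_def)
      qed
      ultimately show ?thesis by - (rule stepI, assumption, assumption, blast)
    qed
  qed
  with assms show ?thesis by blast
qed

lemma Rep_pcomp:
  assumes "Rep p M" "Rep q N"
  shows "Rep (pcomp p q) (comp_trm M N)"
proof -
  from assms obtain P Q where P: "good p" "M \<leadsto> Abs P" "rep p 0 P"
    and Q: "good q" "N \<leadsto> Abs Q" "rep q 0 Q"
    unfolding Rep_def by blast
  let ?N = "lift N 0 \<cdot> Var 0"
  have "wlam (length [M, N] + 1) B_trm (Var 2 \<cdot> (Var 1 \<cdot> Var 0))"
    using wlam_lams[of 3 "Var 2 \<cdot> (Var 1 \<cdot> Var 0)"] by (simp add: B_trm_def eval_nat_numeral)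
  from wlam_apps[OF this] obtain R where R: "comp_trm M N \<leadsto> Abs R" "R \<leadsto> lift M 0 \<cdot> ?N"
    by (auto simp: comp_trm_def senv_def)
  \<comment> \<open>The shift by \<open>lift\<close> is absorbed into a substitution of which only
    the value at index 0 will matter.\<close>
  have lift_app: "\<exists>\<sigma>. lift M 0 \<cdot> X \<leadsto> inst P \<sigma> \<and> \<sigma> 0 = X" if "M \<leadsto> Abs P" for M P X
  proof -
    have "lift M 0 \<cdot> X \<leadsto> Abs (inst P (up (\<lambda>i. Var (Suc i)))) \<cdot> X"
      using whrs_inst[OF that, of "\<lambda>i. Var (Suc i)"] by (intro app_left) (simp add: lift_eq_inst)
    also have "\<dots> \<leadsto> inst P (\<lambda>i. inst (up (\<lambda>i. Var (Suc i)) i) (senv [X]))"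
      using redex by (simp flip: inst_inst)
    finally show ?thesis by (intro exI conjI, assumption) (simp add: senv_def)
  qed
  from lift_app[OF P(2)] obtain \<sigma> where \<sigma>: "lift M 0 \<cdot> ?N \<leadsto> inst P \<sigma>" "\<sigma> 0 = ?N" by blast
  from lift_app[OF Q(2)] obtain \<tau> where \<tau>: "?N \<leadsto> inst Q \<tau>" "\<tau> 0 = Var 0" by blast
  have "rep q 0 (\<sigma> 0)"
    unfolding \<sigma>(2) using rep_rename[of q 0 Q \<tau> 0] Q \<tau> by (auto intro: rep_whrs)
  then have "rep (pcomp p q) 0 R"
    using rep_pcomp[OF P(1) Q(1) P(3)] R(2) \<sigma>(1) by (blast intro: rep_whrs)
  then show ?thesis
    using good_pcomp[OF P(1) Q(1)] R(1) unfolding Rep_def by blast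
qed

section \<open>The inverse of a hereditary permutation is definable\<close>

text \<open>Permutation trees of terms are read off inside the calculus by normalization by evaluation. The
  translation \<open>tr\<close> below turns terms into values \<open>\<lambda>m. m F D\<close>, where \<open>F\<close> is a function and \<open>D\<close> tells
  the shape: \<open>TT\<close> for an abstraction, \<open>NE_data t u\<close> for a variable tagged \<open>t\<close> with the list \<open>u\<close> of its
  arguments, the last one first; \<open>NE t u\<close> is the latter value. \<open>TAG v\<close> is the tag of the head variable of \<open>v\<close>.
  Tags and probes are numerals, and a tag applied to a probe decides their equality: \<open>STEP t p\<close> is
  \<open>p t\<close>, so that the two decrease in turn.

  \<open>READ v x s t p\<close> reads off \<open>v\<close>. As long as \<open>v\<close> is an abstraction, it produces a binder \<open>z\<close> and feeds \<open>v\<close>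
  with a variable of the current tag \<open>t\<close>. Meanwhile \<open>x\<close> accumulates one argument per binder, and
  \<open>s\<close> the binders: \<open>s p u\<close> finds the argument in \<open>u\<close> whose tag equals \<open>p\<close> and inverts it recursively,
  headed by the matching binder. \<open>TT\<close> also serves as a dummy.

  Since \<open>fixp G\<close> does not lift \<open>G\<close>, it is a fixed point for closed \<open>G\<close> only.\<close>

definition fixp :: "trm \<Rightarrow> trm" where
  "fixp G = Abs (G \<cdot> (Var 0 \<cdot> Var 0)) \<cdot> Abs (G \<cdot> (Var 0 \<cdot> Var 0))"

definition "TT = lams 2 (Var 1)"
definition "FF = lams 2 (Var 0)"
definition "LAM = lams 2 (Var 0 \<cdot> Var 1 \<cdot> TT)"
definition "PAIR = lams 3 (Var 0 \<cdot> Var 2 \<cdot> Var 1)"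
definition "NE_data = lams 4 (Var 0 \<cdot> Var 3 \<cdot> Var 2)"
definition "NE_push = lams 4 (Var 3 \<cdot> Var 2 \<cdot> (PAIR \<cdot> Var 0 \<cdot> Var 1))"
definition "NE_fun = lams 4 (Var 0 \<cdot> (NE_push \<cdot> Var 3 \<cdot> Var 2 \<cdot> Var 1) \<cdot> (NE_data \<cdot> Var 2 \<cdot> Var 1))"
definition "NE = fixp NE_fun"
definition "TAG_case = lams 3 (Var 0 \<cdot> (Var 2 \<cdot> (Var 1 \<cdot> TT)) \<cdot> TT)"
definition "TAG_fun = lams 2 (Var 0 \<cdot> (TAG_case \<cdot> Var 1))"
definition "TAG = fixp TAG_fun"
definition "TAG_zero = lams 1 (Var 0 \<cdot> Abs TT \<cdot> FF \<cdot> TT)"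
definition "PROBE_zero = lams 1 FF"
definition "STEP = lams 2 (Var 0 \<cdot> Var 1)"
definition "OUT_step = lams 5 (Var 4 \<cdot> Var 2 \<cdot> Var 1 \<cdot> Var 0 \<cdot> (Var 2 \<cdot> Var 3 \<cdot> Var 0))"
definition "OUT_zero = lams 4 (Var 3)"
definition "FIND_case = lams 6 (TAG \<cdot> Var 1 \<cdot> Var 2 \<cdot> (Var 5 \<cdot> Var 1 \<cdot> (OUT_zero \<cdot> Var 3) \<cdot> TT \<cdot> TAG_zero \<cdot> PROBE_zero)
  \<cdot> (Var 4 \<cdot> Var 2 \<cdot> Var 0))"
definition "FIND_step = lams 5 (Var 0 \<cdot> (FIND_case \<cdot> Var 4 \<cdot> Var 3 \<cdot> Var 2 \<cdot> Var 1))"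
definition "READ_lam = lams 7 (Var 6 \<cdot> (Var 5 \<cdot> (NE \<cdot> Var 2 \<cdot> TT)) \<cdot> (OUT_step \<cdot> Var 4 \<cdot> Var 1)
  \<cdot> (FIND_step \<cdot> Var 6 \<cdot> Var 3 \<cdot> Var 0) \<cdot> (STEP \<cdot> Var 2) \<cdot> (STEP \<cdot> Var 1))"
definition "READ_case = lams 7 (Var 0 \<cdot> (READ_lam \<cdot> Var 6 \<cdot> Var 1 \<cdot> Var 5 \<cdot> Var 4 \<cdot> Var 3 \<cdot> Var 2) \<cdot> (Var 5 \<cdot> Var 4))"
definition "READ_fun = lams 6 (Var 4 \<cdot> (READ_case \<cdot> Var 5 \<cdot> Var 3 \<cdot> Var 2 \<cdot> Var 1 \<cdot> Var 0))"
definition "READ = fixp READ_fun"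

lemma closed_comb1 [simp]: "inst TT \<sigma> = TT" "inst FF \<sigma> = FF" "inst PAIR \<sigma> = PAIR" "inst NE_data \<sigma> = NE_data"
  "inst STEP \<sigma> = STEP" "inst OUT_step \<sigma> = OUT_step" "inst OUT_zero \<sigma> = OUT_zero"
  by (simp_all add: TT_def FF_def PAIR_def NE_data_def STEP_def OUT_step_def OUT_zero_def inst_lams up_funpow_less)

lemma closed_comb2 [simp]: "inst LAM \<sigma> = LAM" "inst NE_push \<sigma> = NE_push" "inst TAG_case \<sigma> = TAG_case" "inst TAG_zero \<sigma> = TAG_zero"
  "inst PROBE_zero \<sigma> = PROBE_zero"
  by (simp_all add: LAM_def NE_push_def TAG_case_def TAG_zero_def PROBE_zero_def inst_lams up_funpow_less)

lemma closed_comb3 [simp]: "inst NE \<sigma> = NE" "inst TAG \<sigma> = TAG"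
  by (simp_all add: NE_def TAG_def NE_fun_def TAG_fun_def fixp_def inst_lams up_funpow_less)

lemma closed_comb4 [simp]: "inst FIND_case \<sigma> = FIND_case" by (simp add: FIND_case_def inst_lams up_funpow_less)
lemma closed_comb5 [simp]: "inst FIND_step \<sigma> = FIND_step" by (simp add: FIND_step_def inst_lams up_funpow_less)
lemma closed_comb6 [simp]: "inst READ_lam \<sigma> = READ_lam" by (simp add: READ_lam_def inst_lams up_funpow_less)
lemma closed_comb7 [simp]: "inst READ_case \<sigma> = READ_case" by (simp add: READ_case_def inst_lams up_funpow_less)
lemma closed_comb8 [simp]: "inst READ \<sigma> = READ" by (simp add: READ_def READ_fun_def fixp_def inst_lams up_funpow_less)

lemma fixp_red: "(\<And>\<sigma>. inst G \<sigma> = G) \<Longrightarrow> fixp G \<leadsto> G \<cdot> fixp G"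
  unfolding fixp_def using redex[of "G \<cdot> (Var 0 \<cdot> Var 0)"] by (simp add: senv_def)

lemma TT_red: "TT \<cdot> a \<cdot> b \<leadsto> a"
  using lams_apps[of "[a, b]" 2 "Var 1"] by (simp add: TT_def senv_def)

lemma FF_red: "FF \<cdot> a \<cdot> b \<leadsto> b"
  using lams_apps[of "[a, b]" 2 "Var 0"] by (simp add: FF_def senv_def)

lemma LAM_red: "LAM \<cdot> f \<cdot> m \<leadsto> m \<cdot> f \<cdot> TT"
  using lams_apps[of "[f, m]" 2 "Var 0 \<cdot> Var 1 \<cdot> TT"] by (simp add: LAM_def senv_def)

lemma PAIR_red: "PAIR \<cdot> a \<cdot> b \<cdot> p \<leadsto> p \<cdot> a \<cdot> b"
  using lams_apps[of "[a, b, p]" 3 "Var 0 \<cdot> Var 2 \<cdot> Var 1"] by (simp add: PAIR_def senv_def)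

lemma NE_data_red: "NE_data \<cdot> t \<cdot> u \<cdot> a \<cdot> b \<leadsto> b \<cdot> t \<cdot> u"
  using lams_apps[of "[t, u, a, b]" 4 "Var 0 \<cdot> Var 3 \<cdot> Var 2"] by (simp add: NE_data_def senv_def)

lemma NE_push_red: "NE_push \<cdot> s \<cdot> t \<cdot> u \<cdot> w \<leadsto> s \<cdot> t \<cdot> (PAIR \<cdot> w \<cdot> u)"
  using lams_apps[of "[s, t, u, w]" 4 "Var 3 \<cdot> Var 2 \<cdot> (PAIR \<cdot> Var 0 \<cdot> Var 1)"]
  by (simp add: NE_push_def senv_def)

text \<open>The first component absorbs one more argument into the list. The second is a selector:
  given two continuations, it hands tag and list to the second one, whereas the \<open>TT\<close> of
  an abstraction picks the first.\<close>

lemma NE_red: "NE \<cdot> t \<cdot> u \<cdot> m \<leadsto> m \<cdot> (NE_push \<cdot> NE \<cdot> t \<cdot> u) \<cdot> (NE_data \<cdot> t \<cdot> u)"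
proof -
  have "NE \<leadsto> NE_fun \<cdot> NE"
    unfolding NE_def by (rule fixp_red) (simp add: NE_fun_def inst_lams up_funpow_less)
  then have "NE \<cdot> t \<cdot> u \<cdot> m \<leadsto> NE_fun \<cdot> NE \<cdot> t \<cdot> u \<cdot> m"
    by (intro app_left)
  also have "\<dots> \<leadsto> m \<cdot> (NE_push \<cdot> NE \<cdot> t \<cdot> u) \<cdot> (NE_data \<cdot> t \<cdot> u)"
    using lams_apps[of "[NE, t, u, m]" 4 "Var 0 \<cdot> (NE_push \<cdot> Var 3 \<cdot> Var 2 \<cdot> Var 1) \<cdot> (NE_data \<cdot> Var 2 \<cdot> Var 1)"]
    by (simp add: NE_fun_def senv_def)
  finally show ?thesis .
qed

lemma TAG_case_red: "TAG_case \<cdot> s \<cdot> f \<cdot> d \<leadsto> d \<cdot> (s \<cdot> (f \<cdot> TT)) \<cdot> TT"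
  using lams_apps[of "[s, f, d]" 3 "Var 0 \<cdot> (Var 2 \<cdot> (Var 1 \<cdot> TT)) \<cdot> TT"]
  by (simp add: TAG_case_def senv_def)

lemma TAG_red: "TAG \<cdot> v \<leadsto> v \<cdot> (TAG_case \<cdot> TAG)"
proof -
  have "TAG \<leadsto> TAG_fun \<cdot> TAG"
    unfolding TAG_def by (rule fixp_red) (simp add: TAG_fun_def inst_lams up_funpow_less)
  then have "TAG \<cdot> v \<leadsto> TAG_fun \<cdot> TAG \<cdot> v"
    by (intro app_left)
  also have "\<dots> \<leadsto> v \<cdot> (TAG_case \<cdot> TAG)"
    using lams_apps[of "[TAG, v]" 2 "Var 0 \<cdot> (TAG_case \<cdot> Var 1)"] by (simp add: TAG_fun_def senv_def)
  finally show ?thesis .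
qed

lemma TAG_zero_red: "TAG_zero \<cdot> p \<leadsto> p \<cdot> Abs TT \<cdot> FF \<cdot> TT"
  using lams_apps[of "[p]" 1 "Var 0 \<cdot> Abs TT \<cdot> FF \<cdot> TT"] by (simp add: TAG_zero_def senv_def)

lemma PROBE_zero_red: "PROBE_zero \<cdot> p \<leadsto> FF"
  using lams_apps[of "[p]" 1 FF] by (simp add: PROBE_zero_def)

lemma STEP_red: "STEP \<cdot> t \<cdot> p \<leadsto> p \<cdot> t"
  using lams_apps[of "[t, p]" 2 "Var 0 \<cdot> Var 1"] by (simp add: STEP_def senv_def)

lemma OUT_step_red: "OUT_step \<cdot> x \<cdot> p \<cdot> s \<cdot> g \<cdot> u \<leadsto> x \<cdot> s \<cdot> g \<cdot> u \<cdot> (s \<cdot> p \<cdot> u)"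
  using lams_apps[of "[x, p, s, g, u]" 5 "Var 4 \<cdot> Var 2 \<cdot> Var 1 \<cdot> Var 0 \<cdot> (Var 2 \<cdot> Var 3 \<cdot> Var 0)"]
  by (simp add: OUT_step_def senv_def)

lemma OUT_zero_red: "OUT_zero \<cdot> x \<cdot> s \<cdot> g \<cdot> u \<leadsto> x"
  using lams_apps[of "[x, s, g, u]" 4 "Var 3"] by (simp add: OUT_zero_def senv_def)

lemma FIND_case_red: "FIND_case \<cdot> h \<cdot> s \<cdot> z \<cdot> p \<cdot> t \<cdot> u
    \<leadsto> TAG \<cdot> t \<cdot> p \<cdot> (h \<cdot> t \<cdot> (OUT_zero \<cdot> z) \<cdot> TT \<cdot> TAG_zero \<cdot> PROBE_zero) \<cdot> (s \<cdot> p \<cdot> u)"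
  using lams_apps[of "[h, s, z, p, t, u]" 6 "TAG \<cdot> Var 1 \<cdot> Var 2
    \<cdot> (Var 5 \<cdot> Var 1 \<cdot> (OUT_zero \<cdot> Var 3) \<cdot> TT \<cdot> TAG_zero \<cdot> PROBE_zero) \<cdot> (Var 4 \<cdot> Var 2 \<cdot> Var 0)"]
  by (simp add: FIND_case_def senv_def)

lemma FIND_step_red: "FIND_step \<cdot> h \<cdot> s \<cdot> z \<cdot> p \<cdot> u \<leadsto> u \<cdot> (FIND_case \<cdot> h \<cdot> s \<cdot> z \<cdot> p)"
  using lams_apps[of "[h, s, z, p, u]" 5 "Var 0 \<cdot> (FIND_case \<cdot> Var 4 \<cdot> Var 3 \<cdot> Var 2 \<cdot> Var 1)"]
  by (simp add: FIND_step_def senv_def)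

text \<open>Seven binders meet six arguments; the one left over is the output binder
  \<open>z\<close>.\<close>

lemma READ_lam_red: "wlam 1 (READ_lam \<cdot> h \<cdot> f \<cdot> x \<cdot> s \<cdot> t \<cdot> p) (lift h 0 \<cdot> (lift f 0 \<cdot> (NE \<cdot> lift t 0 \<cdot> TT))
    \<cdot> (OUT_step \<cdot> lift x 0 \<cdot> lift p 0) \<cdot> (FIND_step \<cdot> lift h 0 \<cdot> lift s 0 \<cdot> Var 0) \<cdot> (STEP \<cdot> lift t 0) \<cdot> (STEP \<cdot> lift p 0))"
proof -
  have "wlam (length [h, f, x, s, t, p] + 1) READ_lam (Var 6 \<cdot> (Var 5 \<cdot> (NE \<cdot> Var 2 \<cdot> TT)) \<cdot> (OUT_step \<cdot> Var 4 \<cdot> Var 1)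
      \<cdot> (FIND_step \<cdot> Var 6 \<cdot> Var 3 \<cdot> Var 0) \<cdot> (STEP \<cdot> Var 2) \<cdot> (STEP \<cdot> Var 1))"
    unfolding READ_lam_def by (simp add: wlam_lams del: wlam.simps One_nat_def funpow.simps)
  from wlam_apps[OF this] show ?thesis
    by (simp add: senv_def del: wlam.simps)
qed

lemma READ_case_red: "READ_case \<cdot> h \<cdot> x \<cdot> s \<cdot> t \<cdot> p \<cdot> f \<cdot> d \<leadsto> d \<cdot> (READ_lam \<cdot> h \<cdot> f \<cdot> x \<cdot> s \<cdot> t \<cdot> p) \<cdot> (x \<cdot> s)"
  using lams_apps[of "[h, x, s, t, p, f, d]" 7
    "Var 0 \<cdot> (READ_lam \<cdot> Var 6 \<cdot> Var 1 \<cdot> Var 5 \<cdot> Var 4 \<cdot> Var 3 \<cdot> Var 2) \<cdot> (Var 5 \<cdot> Var 4)"]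
  by (simp add: READ_case_def senv_def)

lemma READ_red: "READ \<cdot> v \<cdot> x \<cdot> s \<cdot> t \<cdot> p \<leadsto> v \<cdot> (READ_case \<cdot> READ \<cdot> x \<cdot> s \<cdot> t \<cdot> p)"
proof -
  have "READ \<leadsto> READ_fun \<cdot> READ"
    unfolding READ_def by (rule fixp_red) (simp add: READ_fun_def inst_lams up_funpow_less)
  then have "READ \<cdot> v \<cdot> x \<cdot> s \<cdot> t \<cdot> p \<leadsto> READ_fun \<cdot> READ \<cdot> v \<cdot> x \<cdot> s \<cdot> t \<cdot> p"
    by (intro app_left)
  also have "\<dots> \<leadsto> v \<cdot> (READ_case \<cdot> READ \<cdot> x \<cdot> s \<cdot> t \<cdot> p)"
    using lams_apps[of "[READ, v, x, s, t, p]" 6 "Var 4 \<cdot> (READ_case \<cdot> Var 5 \<cdot> Var 3 \<cdot> Var 2 \<cdot> Var 1 \<cdot> Var 0)"]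
    by (simp add: READ_fun_def senv_def)
  finally show ?thesis .
qed

section \<open>Numerals for tags and probes\<close>

definition "tag_num k = ((\<lambda>t. STEP \<cdot> t) ^^ k) TAG_zero"
definition "probe_num k = ((\<lambda>t. STEP \<cdot> t) ^^ k) PROBE_zero"

lemma tag_probe_num_simps [simp]: "tag_num 0 = TAG_zero" "tag_num (Suc k) = STEP \<cdot> tag_num k" "probe_num 0 = PROBE_zero" "probe_num (Suc k) = STEP \<cdot> probe_num k"
  by (simp_all add: tag_num_def probe_num_def)

lemma closed_tag_probe_num [simp]: "inst (tag_num k) \<sigma> = tag_num k" "inst (probe_num k) \<sigma> = probe_num k"
  by (induction k) simp_all

text \<open>A positive tag against \<open>PROBE_zero\<close> gives \<open>FF\<close>.
  \<open>TAG_zero\<close> questions the probe: \<open>PROBE_zero\<close> drops \<open>Abs TT\<close>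
  and leaves \<open>FF\<close>, which picks \<open>TT\<close> out of \<open>FF\<close> and
  \<open>TT\<close>; a positive probe feeds its predecessor to \<open>Abs TT\<close>, and the
  resulting \<open>TT\<close> picks \<open>FF\<close>.\<close>

lemma tag_num_probe_num: "tag_num k \<cdot> probe_num j \<cdot> a \<cdot> b \<leadsto> (if k = j then a else b)"
proof (induction k arbitrary: j)
  case 0
  have 1: "TAG_zero \<cdot> probe_num j \<cdot> a \<cdot> b \<leadsto> probe_num j \<cdot> Abs TT \<cdot> FF \<cdot> TT \<cdot> a \<cdot> b"
    by (intro app_left TAG_zero_red)
  show ?case
  proof (cases j)
    case 0
    note 1
    also have "probe_num j \<cdot> Abs TT \<cdot> FF \<cdot> TT \<cdot> a \<cdot> b \<leadsto> FF \<cdot> FF \<cdot> TT \<cdot> a \<cdot> b"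
      using 0 by (simp add: app_left PROBE_zero_red)
    also have "\<dots> \<leadsto> TT \<cdot> a \<cdot> b" by (intro app_left FF_red)
    also have "\<dots> \<leadsto> a" by (rule TT_red)
    finally show ?thesis using 0 by simp
  next
    case (Suc i)
    note 1
    also have "probe_num j \<cdot> Abs TT \<cdot> FF \<cdot> TT \<cdot> a \<cdot> b \<leadsto> Abs TT \<cdot> probe_num i \<cdot> FF \<cdot> TT \<cdot> a \<cdot> b"
      using Suc by (simp add: app_left STEP_red)
    also have "\<dots> \<leadsto> TT \<cdot> FF \<cdot> TT \<cdot> a \<cdot> b"
      using redex[of TT "probe_num i"] by (intro app_left) simp
    also have "\<dots> \<leadsto> FF \<cdot> a \<cdot> b" by (intro app_left TT_red)
    also have "\<dots> \<leadsto> b" by (rule FF_red)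
    finally show ?thesis using Suc by simp
  qed
next
  case (Suc k)
  have 1: "tag_num (Suc k) \<cdot> probe_num j \<cdot> a \<cdot> b \<leadsto> probe_num j \<cdot> tag_num k \<cdot> a \<cdot> b"
    by (simp add: app_left STEP_red)
  show ?case
  proof (cases j)
    case 0
    note 1
    also have "probe_num j \<cdot> tag_num k \<cdot> a \<cdot> b \<leadsto> FF \<cdot> a \<cdot> b"
      using 0 by (simp add: app_left PROBE_zero_red)
    also have "\<dots> \<leadsto> b" by (rule FF_red)
    finally show ?thesis using 0 by simp
  next
    case (Suc i)
    note 1
    also have "probe_num j \<cdot> tag_num k \<cdot> a \<cdot> b \<leadsto> tag_num k \<cdot> probe_num i \<cdot> a \<cdot> b"
      using Suc by (simp add: app_left STEP_red)
    also have "\<dots> \<leadsto> (if k = i then a else b)" by (rule Suc.IH)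
    finally show ?thesis using Suc by simp
  qed
qed

text \<open>In an application, \<open>TT\<close> selects the function component of the value.
  Variables stay variables, so the translation commutes with substitution and simulates weak head
  reduction.\<close>

primrec tr :: "trm \<Rightarrow> trm" where
  "tr (Var i) = Var i"
| "tr (M \<cdot> N) = tr M \<cdot> TT \<cdot> tr N"
| "tr (Abs M) = LAM \<cdot> Abs (tr M)"

lemma tr_ren: "tr (inst M (\<lambda>i. Var (f i))) = inst (tr M) (\<lambda>i. Var (f i))"
  by (induction M arbitrary: f) (simp_all add: up_ren)

lemma tr_inst: "tr (inst M \<sigma>) = inst (tr M) (\<lambda>i. tr (\<sigma> i))"
proof (induction M arbitrary: \<sigma>)
  case (Abs M)
  have "(\<lambda>i. tr (up \<sigma> i)) = up (\<lambda>i. tr (\<sigma> i))"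
    by (auto simp: up_def fun_eq_iff lift_eq_inst tr_ren split: nat.split)
  with Abs show ?case by simp
qed simp_all

lemma LAM_app: "LAM \<cdot> F \<cdot> TT \<cdot> w \<leadsto> F \<cdot> w"
proof -
  have "LAM \<cdot> F \<cdot> TT \<cdot> w \<leadsto> TT \<cdot> F \<cdot> TT \<cdot> w" by (intro app_left LAM_red)
  also have "\<dots> \<leadsto> F \<cdot> w" by (intro app_left TT_red)
  finally show ?thesis .
qed

lemma tr_whr: "whr M N \<Longrightarrow> tr M \<leadsto> tr N"
proof (induction rule: whr.induct)
  case (whr_redex P Q)
  have "(\<lambda>i. tr (senv [Q] i)) = senv [tr Q]"
    by (auto simp: senv_def fun_eq_iff)
  moreover have "LAM \<cdot> Abs (tr P) \<cdot> TT \<cdot> tr Q \<leadsto> inst (tr P) (senv [tr Q])"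
    using LAM_app redex by (rule whrs_trans)
  ultimately show ?case by (simp add: subst_0 tr_inst)
qed (simp add: app_left)

lemma tr_whrs: "M \<leadsto> N \<Longrightarrow> inst (tr M) \<rho> \<leadsto> inst (tr N) \<rho>"
proof (induction rule: rtranclp_induct)
  case (step N L)
  show ?case by (rule whrs_trans[OF step.IH whrs_inst[OF tr_whr[OF step.hyps(2)]]])
qed simp

lemma NE_app: "NE \<cdot> t \<cdot> u \<cdot> TT \<cdot> w \<leadsto> NE \<cdot> t \<cdot> (PAIR \<cdot> w \<cdot> u)"
proof -
  have "NE \<cdot> t \<cdot> u \<cdot> TT \<cdot> w \<leadsto> TT \<cdot> (NE_push \<cdot> NE \<cdot> t \<cdot> u) \<cdot> (NE_data \<cdot> t \<cdot> u) \<cdot> w"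
    by (intro app_left NE_red)
  also have "\<dots> \<leadsto> NE_push \<cdot> NE \<cdot> t \<cdot> u \<cdot> w" by (intro app_left TT_red)
  also have "\<dots> \<leadsto> NE \<cdot> t \<cdot> (PAIR \<cdot> w \<cdot> u)" by (rule NE_push_red)
  finally show ?thesis .
qed

primrec plist :: "trm list \<Rightarrow> trm \<Rightarrow> trm" where
  "plist [] u = u"
| "plist (w # us) u = PAIR \<cdot> w \<cdot> plist us u"

lemma tr_neutral:
  assumes "\<rho> k = NE \<cdot> t \<cdot> u"
  shows "inst (tr (apps (Var k) Ms)) \<rho>
    \<leadsto> NE \<cdot> t \<cdot> plist (rev (map (\<lambda>M. inst (tr M) \<rho>) Ms)) u"
proof (induction Ms rule: rev_induct)
  case Nil
  then show ?case using assms by simp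
next
  case (snoc M Ms)
  show ?case
    using whrs_trans[OF app_left[OF app_left[OF snoc]] NE_app] by simp
qed

definition scons :: "trm \<Rightarrow> (nat \<Rightarrow> trm) \<Rightarrow> nat \<Rightarrow> trm" where
  "scons X \<rho> i = (case i of 0 \<Rightarrow> X | Suc j \<Rightarrow> \<rho> j)"

lemma redex_up: "Abs (inst P (up \<rho>)) \<cdot> X \<leadsto> inst P (scons X \<rho>)"
proof -
  have "(\<lambda>i. inst (up \<rho> i) (senv [X])) = scons X \<rho>"
    by (auto simp: fun_eq_iff up_def lift_senv senv_def scons_def split: nat.split)
  then show ?thesis using redex[of "inst P (up \<rho>)" X] by (simp add: inst_inst)
qed

text \<open>The dummies fed to the abstractions do no harm, since the head variable
  \<open>n + k\<close> is none of the \<open>n\<close> binders.\<close>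

lemma tag_reads:
  assumes "wlam n M (apps (Var (n + k)) Ms)" "\<rho> k = NE \<cdot> t \<cdot> u"
  shows "inst (tr M) \<rho> \<cdot> (TAG_case \<cdot> TAG) \<leadsto> t"
  using assms
proof (induction n arbitrary: M k \<rho>)
  case 0
  let ?u = "plist (rev (map (\<lambda>M. inst (tr M) \<rho>) Ms)) u"
  have "inst (tr M) \<rho> \<cdot> (TAG_case \<cdot> TAG) \<leadsto> NE \<cdot> t \<cdot> ?u \<cdot> (TAG_case \<cdot> TAG)"
    using 0 by (intro app_left[OF whrs_trans[OF tr_whrs tr_neutral]]) auto
  also have "\<dots> \<leadsto> TAG_case \<cdot> TAG \<cdot> (NE_push \<cdot> NE \<cdot> t \<cdot> ?u) \<cdot> (NE_data \<cdot> t \<cdot> ?u)" by (rule NE_red)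
  also have "\<dots> \<leadsto> NE_data \<cdot> t \<cdot> ?u \<cdot> (TAG \<cdot> (NE_push \<cdot> NE \<cdot> t \<cdot> ?u \<cdot> TT)) \<cdot> TT" by (rule TAG_case_red)
  also have "\<dots> \<leadsto> TT \<cdot> t \<cdot> ?u" by (rule NE_data_red)
  also have "\<dots> \<leadsto> t" by (rule TT_red)
  finally show ?case .
next
  case (Suc n)
  then obtain P where P: "M \<leadsto> Abs P" "wlam n P (apps (Var (n + Suc k)) Ms)" by auto
  let ?F = "Abs (inst (tr P) (up \<rho>))"
  have "inst (tr M) \<rho> \<cdot> (TAG_case \<cdot> TAG) \<leadsto> LAM \<cdot> ?F \<cdot> (TAG_case \<cdot> TAG)"
    using tr_whrs[OF P(1)] by (intro app_left) simp
  also have "\<dots> \<leadsto> TAG_case \<cdot> TAG \<cdot> ?F \<cdot> TT" by (rule LAM_red)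
  also have "\<dots> \<leadsto> TT \<cdot> (TAG \<cdot> (?F \<cdot> TT)) \<cdot> TT" by (rule TAG_case_red)
  also have "\<dots> \<leadsto> TAG \<cdot> (?F \<cdot> TT)" by (rule TT_red)
  also have "\<dots> \<leadsto> ?F \<cdot> TT \<cdot> (TAG_case \<cdot> TAG)" by (rule TAG_red)
  also have "\<dots> \<leadsto> inst (tr P) (scons TT \<rho>) \<cdot> (TAG_case \<cdot> TAG)" by (intro app_left redex_up)
  also have "\<dots> \<leadsto> t" using P(2) Suc.prems(2) by (intro Suc.IH[of _ "Suc k"]) (simp_all add: scons_def)
  finally show ?case .
qed

section \<open>The accumulators of the reader\<close>

primrec out_acc :: "trm \<Rightarrow> nat \<Rightarrow> trm" where
  "out_acc x 0 = OUT_zero \<cdot> x"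
| "out_acc x (Suc i) = OUT_step \<cdot> out_acc x i \<cdot> probe_num i"

primrec find_acc :: "nat list \<Rightarrow> trm" where
  "find_acc [] = TT"
| "find_acc (z # zs) = FIND_step \<cdot> READ \<cdot> find_acc zs \<cdot> Var z"

lemma inst_out_acc: "inst (out_acc x i) \<sigma> = out_acc (inst x \<sigma>) i"
  by (induction i) simp_all

lemma lift_out_acc: "lift (out_acc x i) 0 = out_acc (lift x 0) i"
  by (simp add: lift_eq_inst inst_out_acc)

lemma lift_find_acc: "lift (find_acc zs) 0 = find_acc (map Suc zs)"
  by (induction zs) (simp_all add: lift_eq_inst)

text \<open>\<open>g\<close> is the tag of the head variable, which arrives together with the list
  \<open>u\<close>; it is passed along until \<open>OUT_zero\<close> discards it.\<close>

lemma out_acc_red: "out_acc x i \<cdot> s \<cdot> g \<cdot> u \<leadsto> apps x (map (\<lambda>j. s \<cdot> probe_num j \<cdot> u) [0..<i])"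
proof (induction i)
  case 0
  show ?case by (simp add: OUT_zero_red)
next
  case (Suc i)
  have "out_acc x (Suc i) \<cdot> s \<cdot> g \<cdot> u \<leadsto> out_acc x i \<cdot> s \<cdot> g \<cdot> u \<cdot> (s \<cdot> probe_num i \<cdot> u)"
    by (simp add: OUT_step_red)
  also have "\<dots> \<leadsto> apps x (map (\<lambda>j. s \<cdot> probe_num j \<cdot> u) [0..<i]) \<cdot> (s \<cdot> probe_num i \<cdot> u)"
    by (intro app_left Suc)
  finally show ?case by simp
qed

text \<open>Arguments and binders are scanned in parallel, so the hit comes with the binder of the
  same position. Nothing behind the hit is evaluated, hence the bounds by \<open>l\<close>.\<close>

lemma search:
  assumes "length us = length zs" "l < length zs"
    and "\<And>m. m \<le> l \<Longrightarrow> TAG \<cdot> (us ! m) \<leadsto> tag_num (f m)"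
    and "\<And>m. m \<le> l \<Longrightarrow> f m = j \<longleftrightarrow> m = l"
  shows "find_acc zs \<cdot> probe_num j \<cdot> plist us TT
    \<leadsto> READ \<cdot> (us ! l) \<cdot> (OUT_zero \<cdot> Var (zs ! l)) \<cdot> TT \<cdot> TAG_zero \<cdot> PROBE_zero"
  using assms
proof (induction zs arbitrary: us l f)
  case Nil
  then show ?case by simp
next
  case (Cons z zs)
  then obtain t us' where us: "us = t # us'" by (cases us) auto
  let ?u = "plist us' TT"
  let ?a = "READ \<cdot> t \<cdot> (OUT_zero \<cdot> Var z) \<cdot> TT \<cdot> TAG_zero \<cdot> PROBE_zero" and ?b = "find_acc zs \<cdot> probe_num j \<cdot> ?u"
  have "find_acc (z # zs) \<cdot> probe_num j \<cdot> (PAIR \<cdot> t \<cdot> ?u) \<leadsto> PAIR \<cdot> t \<cdot> ?u \<cdot> (FIND_case \<cdot> READ \<cdot> find_acc zs \<cdot> Var z \<cdot> probe_num j)"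
    by (simp add: FIND_step_red)
  also have "\<dots> \<leadsto> FIND_case \<cdot> READ \<cdot> find_acc zs \<cdot> Var z \<cdot> probe_num j \<cdot> t \<cdot> ?u" by (rule PAIR_red)
  also have "\<dots> \<leadsto> TAG \<cdot> t \<cdot> probe_num j \<cdot> ?a \<cdot> ?b" by (rule FIND_case_red)
  also have "\<dots> \<leadsto> tag_num (f 0) \<cdot> probe_num j \<cdot> ?a \<cdot> ?b"
    using Cons.prems(3)[of 0] us by (intro app_left) simp
  also have "\<dots> \<leadsto> (if f 0 = j then ?a else ?b)" by (rule tag_num_probe_num)
  also have "\<dots> \<leadsto> READ \<cdot> (us ! l) \<cdot> (OUT_zero \<cdot> Var ((z # zs) ! l)) \<cdot> TT \<cdot> TAG_zero \<cdot> PROBE_zero"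
  proof (cases l)
    case 0
    with Cons.prems(4)[of 0] show ?thesis by (simp add: us)
  next
    case (Suc m)
    have "?b \<leadsto> READ \<cdot> (us' ! m) \<cdot> (OUT_zero \<cdot> Var (zs ! m)) \<cdot> TT \<cdot> TAG_zero \<cdot> PROBE_zero"
    proof (rule Cons.IH[where f = "\<lambda>i. f (Suc i)"])
      show "length us' = length zs" "m < length zs" using Cons.prems(1,2) Suc us by simp_all
      show "TAG \<cdot> (us' ! i) \<leadsto> tag_num (f (Suc i))" if "i \<le> m" for i
        using Cons.prems(3)[of "Suc i"] that Suc us by simp
      show "f (Suc i) = j \<longleftrightarrow> i = m" if "i \<le> m" for i
        using Cons.prems(4)[of "Suc i"] that Suc by simp
    qed
    with Cons.prems(4)[of 0] Suc show ?thesis by (simp add: us)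
  qed
  finally show ?case by (simp add: us)
qed

text \<open>The state reached below the \<open>n\<close> abstractions of \<open>M\<close>: \<open>\<rho>'\<close> extends \<open>\<rho>\<close> by the tagged variables that have
  been fed in, and the binders are \<open>Var 0, \<dots>, Var (n - 1)\<close>, the last one first.\<close>

lemma READ_state:
  assumes "wlam n M (apps (Var (n + k)) Ms)" "\<rho> k = NE \<cdot> tag_num t \<cdot> TT"
  shows "\<exists>\<rho>'. wlam n (inst (tr M) \<rho> \<cdot> (READ_case \<cdot> READ \<cdot> out_acc (Var a) i \<cdot> find_acc zs \<cdot> tag_num i \<cdot> probe_num i))
      (out_acc (Var (a + n)) (i + n) \<cdot> find_acc ([0..<n] @ map (\<lambda>z. z + n) zs) \<cdot> tag_num t
        \<cdot> plist (rev (map (\<lambda>M. inst (tr M) \<rho>') Ms)) TT)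
    \<and> (\<forall>c<n. \<rho>' c = NE \<cdot> tag_num (i + n - Suc c) \<cdot> TT)
    \<and> (\<forall>c s. \<rho> c = NE \<cdot> tag_num s \<cdot> TT \<longrightarrow> \<rho>' (c + n) = NE \<cdot> tag_num s \<cdot> TT)"
  using assms
proof (induction n arbitrary: M k \<rho> a i zs)
  case 0
  let ?u = "plist (rev (map (\<lambda>M. inst (tr M) \<rho>) Ms)) TT"
  let ?G = "READ_case \<cdot> READ \<cdot> out_acc (Var a) i \<cdot> find_acc zs \<cdot> tag_num i \<cdot> probe_num i"
  have "inst (tr M) \<rho> \<cdot> ?G \<leadsto> NE \<cdot> tag_num t \<cdot> ?u \<cdot> ?G"
    using 0 by (intro app_left[OF whrs_trans[OF tr_whrs tr_neutral]]) auto
  also have "\<dots> \<leadsto> ?G \<cdot> (NE_push \<cdot> NE \<cdot> tag_num t \<cdot> ?u) \<cdot> (NE_data \<cdot> tag_num t \<cdot> ?u)" by (rule NE_red)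
  also have "\<dots> \<leadsto> NE_data \<cdot> tag_num t \<cdot> ?u \<cdot> (READ_lam \<cdot> READ \<cdot> (NE_push \<cdot> NE \<cdot> tag_num t \<cdot> ?u) \<cdot> out_acc (Var a) i
      \<cdot> find_acc zs \<cdot> tag_num i \<cdot> probe_num i) \<cdot> (out_acc (Var a) i \<cdot> find_acc zs)" by (rule READ_case_red)
  also have "\<dots> \<leadsto> out_acc (Var a) i \<cdot> find_acc zs \<cdot> tag_num t \<cdot> ?u" by (rule NE_data_red)
  finally show ?case by (intro exI[of _ \<rho>]) simp
next
  case (Suc n)
  then obtain P where P: "M \<leadsto> Abs P" "wlam n P (apps (Var (n + Suc k)) Ms)" by auto
  let ?F = "Abs (inst (tr P) (up \<rho>))"
  let ?G = "READ_case \<cdot> READ \<cdot> out_acc (Var a) i \<cdot> find_acc zs \<cdot> tag_num i \<cdot> probe_num i"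
  let ?L = "READ_lam \<cdot> READ \<cdot> ?F \<cdot> out_acc (Var a) i \<cdot> find_acc zs \<cdot> tag_num i \<cdot> probe_num i"
  \<comment> \<open>The variable fed in is tagged by the number of binders passed so far; the new
    output binder lifts the old environment.\<close>
  let ?y = "NE \<cdot> tag_num i \<cdot> TT"
  let ?\<rho> = "scons ?y (\<lambda>c. lift (\<rho> c) 0)"
  have "inst (tr M) \<rho> \<cdot> ?G \<leadsto> LAM \<cdot> ?F \<cdot> ?G"
    using tr_whrs[OF P(1)] by (intro app_left) simp
  also have "\<dots> \<leadsto> ?G \<cdot> ?F \<cdot> TT" by (rule LAM_red)
  also have "\<dots> \<leadsto> TT \<cdot> ?L \<cdot> (out_acc (Var a) i \<cdot> find_acc zs)" by (rule READ_case_red)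
  also have "\<dots> \<leadsto> ?L" by (rule TT_red)
  finally have 1: "inst (tr M) \<rho> \<cdot> ?G \<leadsto> ?L" .
  have "wlam 1 ?L (READ \<cdot> (lift ?F 0 \<cdot> ?y) \<cdot> out_acc (Var (Suc a)) (Suc i) \<cdot> find_acc (0 # map Suc zs)
      \<cdot> tag_num (Suc i) \<cdot> probe_num (Suc i))"
    using READ_lam_red[of READ ?F "out_acc (Var a) i" "find_acc zs" "tag_num i" "probe_num i"]
    by (simp add: lift_out_acc lift_find_acc del: lift.simps(3)) (simp add: lift_eq_inst)
  then have 2: "wlam 1 (inst (tr M) \<rho> \<cdot> ?G) (READ \<cdot> (lift ?F 0 \<cdot> ?y) \<cdot> out_acc (Var (Suc a)) (Suc i)
      \<cdot> find_acc (0 # map Suc zs) \<cdot> tag_num (Suc i) \<cdot> probe_num (Suc i))"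
    using 1 by (rule wlam_whrs[rotated])
  let ?G' = "READ_case \<cdot> READ \<cdot> out_acc (Var (Suc a)) (Suc i) \<cdot> find_acc (0 # map Suc zs) \<cdot> tag_num (Suc i) \<cdot> probe_num (Suc i)"
  have "lift ?F 0 = Abs (inst (tr P) (up (\<lambda>c. lift (\<rho> c) 0)))"
    using lift_inst[of "Abs (tr P)" \<rho>] by simp
  then have "lift ?F 0 \<cdot> ?y \<leadsto> inst (tr P) ?\<rho>"
    by (simp add: redex_up)
  then have "lift ?F 0 \<cdot> ?y \<cdot> ?G' \<leadsto> inst (tr P) ?\<rho> \<cdot> ?G'" by (rule app_left)
  with 2 READ_red have 3: "wlam 1 (inst (tr M) \<rho> \<cdot> ?G) (inst (tr P) ?\<rho> \<cdot> ?G')"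
    by (blast intro: wlam_body)
  have "?\<rho> (Suc k) = NE \<cdot> tag_num t \<cdot> TT"
    using Suc.prems(2) by (simp add: scons_def lift_eq_inst)
  from Suc.IH[of P "Suc k" ?\<rho> "Suc a" "Suc i" "0 # map Suc zs", OF P(2) this] obtain \<rho>' where
    4: "wlam n (inst (tr P) ?\<rho> \<cdot> ?G')
      (out_acc (Var (Suc a + n)) (Suc i + n) \<cdot> find_acc ([0..<n] @ map (\<lambda>z. z + n) (0 # map Suc zs)) \<cdot> tag_num t
        \<cdot> plist (rev (map (\<lambda>M. inst (tr M) \<rho>') Ms)) TT)"
    and 5: "\<forall>c<n. \<rho>' c = NE \<cdot> tag_num (Suc i + n - Suc c) \<cdot> TT"
    and 6: "\<forall>c s. ?\<rho> c = NE \<cdot> tag_num s \<cdot> TT \<longrightarrow> \<rho>' (c + n) = NE \<cdot> tag_num s \<cdot> TT"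
    by blast
  have "wlam (Suc n) (inst (tr M) \<rho> \<cdot> ?G)
    (out_acc (Var (a + Suc n)) (i + Suc n) \<cdot> find_acc ([0..<Suc n] @ map (\<lambda>z. z + Suc n) zs) \<cdot> tag_num t
        \<cdot> plist (rev (map (\<lambda>M. inst (tr M) \<rho>') Ms)) TT)"
    using wlam_trans[OF 3 4] by (simp add: comp_def del: out_acc.simps)
  moreover have "\<forall>c<Suc n. \<rho>' c = NE \<cdot> tag_num (i + Suc n - Suc c) \<cdot> TT"
    using 5 6[rule_format, of 0 i] by (auto simp: less_Suc_eq scons_def)
  moreover have "\<forall>c s. \<rho> c = NE \<cdot> tag_num s \<cdot> TT \<longrightarrow> \<rho>' (c + Suc n) = NE \<cdot> tag_num s \<cdot> TT"
  proof (intro allI impI)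
    fix c s assume "\<rho> c = NE \<cdot> tag_num s \<cdot> TT"
    then show "\<rho>' (c + Suc n) = NE \<cdot> tag_num s \<cdot> TT"
      using 6[rule_format, of "Suc c" s] by (simp add: scons_def lift_eq_inst)
  qed
  ultimately show ?case by blast
qed

text \<open>The \<open>i\<close>-th argument of \<open>M\<close> is headed by the variable tagged
  \<open>perm p i\<close>. Output argument \<open>j\<close> searches for tag \<open>j\<close>, so it
  finds the argument at the preimage of \<open>j\<close> and is headed by the output binder of that
  number, as \<open>pinv\<close> requires. Tags may restart at zero in each recursive call because
  the arguments at a node are headed by binders of that same node.\<close>

lemma rep_pinv:
  assumes "good p" "rep p k M" "\<rho> k = NE \<cdot> tag_num t \<cdot> TT"
    "X \<leadsto> READ \<cdot> inst (tr M) \<rho> \<cdot> (OUT_zero \<cdot> Var a) \<cdot> TT \<cdot> TAG_zero \<cdot> PROBE_zero"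
  shows "rep (pinv p) a X"
proof -
  let ?R = "\<lambda>q a X. \<exists>p k M \<rho> t. q = pinv p \<and> good p \<and> rep p k M \<and> \<rho> k = NE \<cdot> tag_num t \<cdot> TT
    \<and> X \<leadsto> READ \<cdot> inst (tr M) \<rho> \<cdot> (OUT_zero \<cdot> Var a) \<cdot> TT \<cdot> TAG_zero \<cdot> PROBE_zero"
  have "rep q a X" if "?R q a X" for q a X
    using that
  proof (coinduction arbitrary: q a X)
    case (rep q a X)
    then obtain p k M \<rho> t where q: "q = pinv p" and p: "good p" and M: "rep p k M"
      and \<rho>: "\<rho> k = NE \<cdot> tag_num t \<cdot> TT"
      and X: "X \<leadsto> READ \<cdot> inst (tr M) \<rho> \<cdot> (OUT_zero \<cdot> Var a) \<cdot> TT \<cdot> TAG_zero \<cdot> PROBE_zero" by blast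
    let ?n = "arity p"
    from M obtain Ms where Ms: "wlam ?n M (apps (Var (?n + k)) Ms)" "length Ms = ?n"
      "\<And>i. i < ?n \<Longrightarrow> rep (child p i) (?n - Suc (perm p i)) (Ms ! i)"
      by (rule repE) blast
    let ?us = "\<lambda>\<rho>'. rev (map (\<lambda>M. inst (tr M) \<rho>') Ms)"
    let ?u = "\<lambda>\<rho>'. plist (?us \<rho>') TT"
    from READ_state[OF Ms(1), of \<rho>, OF \<rho>, of a 0 "[]"] obtain \<rho>' where
      1: "wlam ?n (inst (tr M) \<rho> \<cdot> (READ_case \<cdot> READ \<cdot> (OUT_zero \<cdot> Var a) \<cdot> TT \<cdot> TAG_zero \<cdot> PROBE_zero))
        (out_acc (Var (?n + a)) ?n \<cdot> find_acc [0..<?n] \<cdot> tag_num t \<cdot> ?u \<rho>')"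
      and 2: "\<forall>c<?n. \<rho>' c = NE \<cdot> tag_num (?n - Suc c) \<cdot> TT"
      by (auto simp: add.commute)
    define Ns where "Ns = map (\<lambda>j. find_acc [0..<?n] \<cdot> probe_num j \<cdot> ?u \<rho>') [0..<?n]"
    have "wlam ?n X (apps (Var (?n + a)) Ns)"
      unfolding Ns_def using wlam_whrs[OF whrs_trans[OF X READ_red] 1] out_acc_red by (rule wlam_body)
    moreover have "length Ns = ?n" by (simp add: Ns_def)
    moreover have "?R (pinv (child p i)) (?n - Suc i) (Ns ! perm p i)" if i: "i < ?n" for i
    proof -
      have rd: "TAG \<cdot> (?us \<rho>' ! m) \<leadsto> tag_num (perm p (?n - Suc m))" if "m < ?n" for m
      proof -
        let ?M = "Ms ! (?n - Suc m)"
        let ?j = "perm p (?n - Suc m)"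
        have j: "?j < ?n" using that good_perm(1)[OF p] by simp
        have "?us \<rho>' ! m = inst (tr ?M) \<rho>'" using that by (simp add: rev_nth Ms(2))
        moreover have "\<rho>' (?n - Suc ?j) = NE \<cdot> tag_num ?j \<cdot> TT" using 2 j by simp
        moreover have "rep (child p (?n - Suc m)) (?n - Suc ?j) ?M" using that by (intro Ms(3)) simp
        ultimately show ?thesis
          using whrs_trans[OF TAG_red tag_reads] by (metis repE)
      qed
      have pi: "perm p i < ?n" using i good_perm(1)[OF p] by simp
      \<comment> \<open>The last argument comes first, so \<open>Ms ! i\<close> stands at position
        \<open>?n - Suc i\<close>, whose entry in \<open>[0..<?n]\<close> is the index of output
        binder \<open>i\<close>.\<close>
      have "find_acc [0..<?n] \<cdot> probe_num (perm p i) \<cdot> ?u \<rho>'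
          \<leadsto> READ \<cdot> (?us \<rho>' ! (?n - Suc i)) \<cdot> (OUT_zero \<cdot> Var ([0..<?n] ! (?n - Suc i))) \<cdot> TT \<cdot> TAG_zero \<cdot> PROBE_zero"
      proof (rule search[where f = "\<lambda>m. perm p (?n - Suc m)"])
        show "length (?us \<rho>') = length [0..<?n]" "?n - Suc i < length [0..<?n]"
          using i Ms(2) by simp_all
        fix m assume m: "m \<le> ?n - Suc i"
        then show "TAG \<cdot> (?us \<rho>' ! m) \<leadsto> tag_num (perm p (?n - Suc m))"
          using i by (intro rd) simp
        have "perm p (?n - Suc m) = perm p i \<longleftrightarrow> ?n - Suc m = i"
          using bij_is_inj[OF good_perm(3)[OF p]] by (simp add: inj_eq)
        also have "\<dots> \<longleftrightarrow> m = ?n - Suc i" using m i by auto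
        finally show "perm p (?n - Suc m) = perm p i \<longleftrightarrow> m = ?n - Suc i" .
      qed
      then have "Ns ! perm p i \<leadsto> READ \<cdot> inst (tr (Ms ! i)) \<rho>' \<cdot> (OUT_zero \<cdot> Var (?n - Suc i)) \<cdot> TT \<cdot> TAG_zero \<cdot> PROBE_zero"
        using i pi by (simp add: Ns_def rev_nth Ms(2))
      moreover have "\<rho>' (?n - Suc (perm p i)) = NE \<cdot> tag_num (perm p i) \<cdot> TT"
        using 2 pi by simp
      ultimately show ?thesis
        using Ms(3)[OF i] goodD(3)[OF p] by blast
    qed
    then have "?R (child q j) (?n - Suc (perm q j)) (Ns ! j)" if "j < ?n" for j
      using that good_inv_perm(1)[OF p, of j] good_perm(1)[OF p, of "inv_into UNIV (perm p) j"]
      by (metis q child_pinv pinv.simps(1) snd_conv)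
    ultimately show ?case
      by (intro exI[of _ q] exI[of _ X] exI[of _ a] exI[of _ Ns]) (simp add: q)
  qed
  with assms show ?thesis by blast
qed

lemma Rep_pinv:
  assumes "Rep p M"
  obtains N where "Rep (pinv p) N"
proof -
  from assms obtain P where P: "good p" "rep p 0 P" by (auto simp: Rep_def)
  \<comment> \<open>The tag of the root variable is arbitrary, since it is discarded; the values at
    other indices do not matter either.\<close>
  have "rep (pinv p) 0 (READ \<cdot> inst (tr P) (\<lambda>_. NE \<cdot> tag_num 0 \<cdot> TT) \<cdot> (OUT_zero \<cdot> Var 0) \<cdot> TT \<cdot> TAG_zero \<cdot> PROBE_zero)"
    by (rule rep_pinv[OF P, of "\<lambda>_. NE \<cdot> tag_num 0 \<cdot> TT" 0]) simp_all
  then show ?thesis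
    using that good_pinv[OF P(1)] unfolding Rep_def by blast
qed

section \<open>Separation of permutation trees\<close>

lemma whr_beta: "whr M N \<Longrightarrow> beta M N"
  by (induction rule: whr.induct) (auto intro: beta.intros)

lemma inst_shift_senv:
  "length Xs = n \<Longrightarrow> inst (inst X (\<lambda>j. Var (j + n))) (senv (rev Xs)) = X"
  by (simp add: inst_ren senv_def)

text \<open>The head variable becomes the constant function of \<open>length Ds\<close> arguments.
  It receives exactly that many: \<open>arity p\<close> from the body and the rest of
  \<open>Ds\<close>.\<close>

lemma rep_head:
  assumes "rep p a M" "arity p \<le> length Ds"
    and \<sigma>: "\<sigma> a = lams (length Ds) (inst X (\<lambda>j. Var (j + length Ds)))"
  shows "apps (inst M \<sigma>) Ds \<leadsto> X"
proof -
  let ?n = "arity p" and ?L = "length Ds"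
  from assms(1) obtain Ms where Ms: "wlam ?n M (apps (Var (?n + a)) Ms)" "length Ms = ?n"
    by (rule repE) blast
  let ?Ms = "map (\<lambda>N. inst (inst N ((up ^^ ?n) \<sigma>)) (senv (rev (take ?n Ds)))) Ms"
  have len: "length (take ?n Ds) = ?n" using assms(2) by simp
  have "wlam (length (take ?n Ds) + 0) (inst M \<sigma>) (inst (apps (Var (?n + a)) Ms) ((up ^^ ?n) \<sigma>))"
    using wlam_inst[OF Ms(1), of \<sigma>] unfolding len by simp
  from wlam_apps[OF this] have "apps (inst M \<sigma>) (take ?n Ds) \<leadsto> apps (\<sigma> a) ?Ms"
    using up_funpow_add[of ?n \<sigma> a] inst_shift_senv[OF len, of "\<sigma> a"]
    by (simp add: add.commute comp_def)
  then have "apps (apps (inst M \<sigma>) (take ?n Ds)) (drop ?n Ds) \<leadsto> apps (apps (\<sigma> a) ?Ms) (drop ?n Ds)"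
    by (rule apps_left)
  then have "apps (inst M \<sigma>) Ds \<leadsto> apps (\<sigma> a) (?Ms @ drop ?n Ds)"
    by (simp flip: foldl_append)
  also have "\<dots> \<leadsto> X"
  proof -
    have l: "length (?Ms @ drop ?n Ds) = ?L" using assms(2) Ms(2) by simp
    show ?thesis
      using lams_apps[OF l, of "inst X (\<lambda>j. Var (j + ?L))"] unfolding inst_shift_senv[OF l] \<sigma> .
  qed
  finally show ?thesis .
qed

lemma rep_applied:
  assumes "good p" "rep p k M" "arity p \<le> L"
  obtains Zs where "length Zs = L"
    "\<And>i. i < L \<Longrightarrow> rep (child p i) (L - Suc (perm p i)) (Zs ! i)"
    "apps (inst M (\<lambda>j. Var (j + L))) (map Var (rev [0..<L])) \<leadsto> apps (Var (k + L)) Zs"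
proof -
  \<comment> \<open>The fresh arguments are numbered like binders: the first one is index
    \<open>L - 1\<close>, the last one index 0.\<close>
  let ?n = "arity p" and ?M = "inst M (\<lambda>j. Var (j + L))" and ?Xs = "map Var (rev [0..<L])"
  have "rep p (k + L) ?M" using assms(1,2) by (rule rep_rename) simp
  then obtain Ms where Ms: "wlam ?n ?M (apps (Var (?n + (k + L))) Ms)" "length Ms = ?n"
    "\<And>i. i < ?n \<Longrightarrow> rep (child p i) (?n - Suc (perm p i)) (Ms ! i)"
    by (rule repE) blast
  let ?\<tau> = "senv (rev (take ?n ?Xs))"
  define Zs where "Zs = map (\<lambda>N. inst N ?\<tau>) Ms @ drop ?n ?Xs"
  have len: "length (take ?n ?Xs) = ?n" using assms(3) by simp
  have "wlam (length (take ?n ?Xs) + 0) ?M (apps (Var (?n + (k + L))) Ms)"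
    using Ms(1) unfolding len by simp
  moreover have "?\<tau> (?n + (k + L)) = Var (k + L)"
    using len by (simp add: senv_def)
  ultimately have "apps ?M (take ?n ?Xs) \<leadsto> apps (Var (k + L)) (map (\<lambda>N. inst N ?\<tau>) Ms)"
    using wlam_apps[of "take ?n ?Xs" 0 ?M "apps (Var (?n + (k + L))) Ms"] by simp
  then have "apps (apps ?M (take ?n ?Xs)) (drop ?n ?Xs)
      \<leadsto> apps (apps (Var (k + L)) (map (\<lambda>N. inst N ?\<tau>) Ms)) (drop ?n ?Xs)"
    by (rule apps_left)
  then have "apps ?M ?Xs \<leadsto> apps (Var (k + L)) Zs"
    unfolding Zs_def by (metis append_take_drop_id foldl_append)
  moreover have "rep (child p i) (L - Suc (perm p i)) (Zs ! i)" if i: "i < L" for i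
  proof (cases "i < ?n")
    case True
    then have "perm p i < ?n" using good_perm(1)[OF assms(1)] by simp
    then have "?\<tau> (?n - Suc (perm p i)) = Var (L - Suc (perm p i))"
      using len assms(3) by (simp add: senv_def rev_nth)
    with Ms(3)[OF True] True show ?thesis
      using goodD(3)[OF assms(1)] by (auto simp: Zs_def nth_append Ms(2) intro: rep_rename)
  next
    case False
    then have "perm p i = i" "child p i = triv"
      using good_perm(2)[OF assms(1)] goodD(2)[OF assms(1)] by simp_all
    with False i assms(3) show ?thesis
      by (simp add: Zs_def nth_append Ms(2) rev_nth rep_triv)
  qed
  moreover have "length Zs = L" using assms(3) by (simp add: Zs_def Ms(2))
  ultimately show ?thesis using that by blast
qed

section \<open>Substitutivity and separation in a lambda theory\<close>

context lambda_theory
begin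

lemma T_whrs: "M \<leadsto> N \<Longrightarrow> (M, N) \<in> T"
proof (induction rule: rtranclp_induct)
  case (step N L)
  show ?case by (rule T_trans[OF step.IH beta_in[OF whr_beta[OF step.hyps(2)]]])
qed (rule T_refl)

lemma T_square: "(M, N) \<in> T \<Longrightarrow> (M, M') \<in> T \<Longrightarrow> (N, N') \<in> T \<Longrightarrow> (M', N') \<in> T"
  by (rule T_trans[OF T_sym T_trans])

lemma T_apps: "(M, N) \<in> T \<Longrightarrow> (apps M Qs, apps N Qs) \<in> T"
  by (induction Qs arbitrary: M N) (auto intro: app T_refl)

lemma T_lams: "(M, N) \<in> T \<Longrightarrow> (lams n M, lams n N) \<in> T"
  by (induction n) (auto intro: abs)

text \<open>Abstracting over all relevant indices and applying to their images reduces substitution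
  to the congruence rules and beta.\<close>

lemma T_inst:
  assumes "(M, N) \<in> T"
  shows "(inst M \<sigma>, inst N \<sigma>) \<in> T"
proof -
  obtain K where K: "\<forall>\<sigma> \<tau>. (\<forall>i<K. \<sigma> i = \<tau> i) \<longrightarrow> inst M \<sigma> = inst M \<tau>"
    using inst_support by blast
  obtain L where L: "\<forall>\<sigma> \<tau>. (\<forall>i<L. \<sigma> i = \<tau> i) \<longrightarrow> inst N \<sigma> = inst N \<tau>"
    using inst_support by blast
  let ?n = "max K L"
  let ?Xs = "rev (map \<sigma> [0..<?n])"
  have *: "senv (map \<sigma> [0..<?n]) i = \<sigma> i" if "i < ?n" for i
    using that by (simp add: senv_def)
  have eqM: "inst M (senv (rev ?Xs)) = inst M \<sigma>"
    by (rule mp[OF spec[OF spec[OF K]]]) (simp add: *)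
  have eqN: "inst N (senv (rev ?Xs)) = inst N \<sigma>"
    by (rule mp[OF spec[OF spec[OF L]]]) (simp add: *)
  have "length ?Xs = ?n" by simp
  then have **: "(apps (lams ?n P) ?Xs, inst P (senv (rev ?Xs))) \<in> T" for P
    by (rule T_whrs[OF lams_apps])
  have "(apps (lams ?n M) ?Xs, apps (lams ?n N) ?Xs) \<in> T"
    using assms by (rule T_apps[OF T_lams])
  from T_square[OF this ** **] show ?thesis
    unfolding eqM eqN .
qed

text \<open>Different head variables can be replaced by constant functions with arbitrary values
  \<open>X\<close> and \<open>Y\<close>, so such an identification makes the theory
  inconsistent.\<close>

lemma collapse:
  assumes "rep p a M" "rep q b N" "(M, N) \<in> T" "a \<noteq> b"
  shows "(X, Y) \<in> T"
proof -
  let ?L = "max (arity p) (arity q)"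
  define Ds where "Ds = replicate ?L (Var 0)"
  have L: "length Ds = ?L" by (simp add: Ds_def)
  let ?\<sigma> = "\<lambda>i. lams ?L (inst (if i = a then X else Y) (\<lambda>j. Var (j + ?L)))"
  have 1: "apps (inst M ?\<sigma>) Ds \<leadsto> X"
    using assms(1) by (rule rep_head) (simp_all add: L)
  have 2: "apps (inst N ?\<sigma>) Ds \<leadsto> Y"
    using assms(2) by (rule rep_head) (simp_all add: L assms(4)[symmetric])
  have "(apps (inst M ?\<sigma>) Ds, apps (inst N ?\<sigma>) Ds) \<in> T"
    using assms(3) by (intro T_apps T_inst)
  then show ?thesis by (rule T_square[OF _ T_whrs[OF 1] T_whrs[OF 2]])
qed

lemma rep_children:
  assumes "good p" "good q" "rep p k M" "rep q k N" "(M, N) \<in> T"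
    "arity p \<le> L" "arity q \<le> L" "i < L"
  obtains M' N' where "rep (child p i) (L - Suc (perm p i)) M'"
    "rep (child q i) (L - Suc (perm q i)) N'" "(M', N') \<in> T"
proof -
  let ?s = "\<lambda>M. apps (inst M (\<lambda>j. Var (j + L))) (map Var (rev [0..<L]))"
  obtain Zs where Zs: "length Zs = L" "rep (child p i) (L - Suc (perm p i)) (Zs ! i)"
    "?s M \<leadsto> apps (Var (k + L)) Zs"
    using rep_applied[OF assms(1,3,6)] assms(8) by metis
  obtain Ws where Ws: "length Ws = L" "rep (child q i) (L - Suc (perm q i)) (Ws ! i)"
    "?s N \<leadsto> apps (Var (k + L)) Ws"
    using rep_applied[OF assms(2,4,7)] assms(8) by metis
  have "(?s M, ?s N) \<in> T" using assms(5) by (intro T_apps T_inst)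
  then have 1: "(apps (Var (k + L)) Zs, apps (Var (k + L)) Ws) \<in> T"
    by (rule T_square[OF _ T_whrs[OF Zs(3)] T_whrs[OF Ws(3)]])
  \<comment> \<open>The head variable becomes the \<open>i\<close>-th projection among
    \<open>L\<close> arguments.\<close>
  define \<sigma> where "\<sigma> = (\<lambda>c. if c = k + L then lams L (Var (L - Suc i)) else Var c)"
  have proj: "(inst (apps (Var (k + L)) Zs) \<sigma>, inst (Zs ! i) \<sigma>) \<in> T" if "length Zs = L" for Zs
  proof -
    have "inst (apps (Var (k + L)) Zs) \<sigma> \<leadsto> inst (Var (L - Suc i)) (senv (rev (map (\<lambda>N. inst N \<sigma>) Zs)))"
      using lams_apps[of "map (\<lambda>N. inst N \<sigma>) Zs" L "Var (L - Suc i)"] that by (simp add: \<sigma>_def)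
    moreover have "senv (rev (map (\<lambda>N. inst N \<sigma>) Zs)) (L - Suc i) = inst (Zs ! i) \<sigma>"
      using assms(8) that by (simp add: senv_def rev_nth)
    ultimately show ?thesis by (simp add: T_whrs)
  qed
  have 2: "(inst (Zs ! i) \<sigma>, inst (Ws ! i) \<sigma>) \<in> T"
    using T_inst[OF 1, of \<sigma>] proj[OF Zs(1)] proj[OF Ws(1)] by (rule T_square)
  \<comment> \<open>The selected child is headed by one of the fresh variables, not by the variable
    just replaced, so it keeps its tree.\<close>
  have 3: "rep r (L - Suc c) (inst P \<sigma>)" if "good r" "rep r (L - Suc c) P" for r c P
  proof -
    have "L - Suc c \<noteq> k + L" using assms(8) by linarith
    then have "\<sigma> (L - Suc c) = Var (L - Suc c)" unfolding \<sigma>_def by (rule if_not_P)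
    with that show ?thesis by (rule rep_rename)
  qed
  show ?thesis
    by (rule that[OF 3[OF goodD(3)[OF assms(1)] Zs(2)] 3[OF goodD(3)[OF assms(2)] Ws(2)] 2])
qed

text \<open>The pair \<open>X\<close>, \<open>Y\<close> witnesses consistency. Applying both terms
  to a common number of fresh variables evens out the arities, about which nothing is
  concluded.\<close>

lemma rep_separate:
  assumes "good p" "good q" "rep p k M" "rep q k N" "(M, N) \<in> T" "(X, Y) \<notin> T"
  shows "snd (p w) = snd (q w)"
  using assms(1-5)
proof (induction w arbitrary: p q k M N)
  have perm_eq: "perm p i = perm q i"
    if "good p" "good q" "rep p k M" "rep q k N" "(M, N) \<in> T" for p q k M N i
  proof (cases "i < max (arity p) (arity q)")
    note prems = that
    case True
    let ?L = "max (arity p) (arity q)"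
    obtain M' N' where "rep (child p i) (?L - Suc (perm p i)) M'"
      "rep (child q i) (?L - Suc (perm q i)) N'" "(M', N') \<in> T"
      using rep_children[OF prems, of ?L i] True by auto
    then have "?L - Suc (perm p i) = ?L - Suc (perm q i)"
      using collapse assms(6) by blast
    moreover have "perm p i < ?L" "perm q i < ?L"
      using True good_perm(4)[OF prems(1), of ?L i] good_perm(4)[OF prems(2), of ?L i] by simp_all
    ultimately show ?thesis by linarith
  next
    case False
    with that show ?thesis by (simp add: good_perm(2))
  qed
  {
    case Nil
    then show ?case using perm_eq by blast
  next
    case (Cons i w)
    let ?L = "max (arity p) (arity q)"
    have "snd (child p i w) = snd (child q i w)"
    proof (cases "i < ?L")
      case True
      then obtain M' N' where "rep (child p i) (?L - Suc (perm p i)) M'"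
        "rep (child q i) (?L - Suc (perm q i)) N'" "(M', N') \<in> T"
        using rep_children[OF Cons.prems, of ?L i] by auto
      with Cons.IH[of "child p i" "child q i"] show ?thesis
        using goodD(3) Cons.prems(1,2) perm_eq[OF Cons.prems] by metis
    next
      case False
      with Cons.prems(1,2) show ?thesis by (simp add: goodD(2))
    qed
    then show ?case by (simp add: child_def)
  }
qed

lemma Rep_separate:
  assumes "Rep p M" "Rep q N" "(M, N) \<in> T" "(X, Y) \<notin> T"
  shows "snd (p w) = snd (q w)"
proof -
  from assms(1,2) obtain P Q where P: "good p" "M \<leadsto> Abs P" "rep p 0 P"
    and Q: "good q" "N \<leadsto> Abs Q" "rep q 0 Q" unfolding Rep_def by blast
  have 1: "(inst M (\<lambda>j. Var (Suc j)) \<cdot> Var 0, inst N (\<lambda>j. Var (Suc j)) \<cdot> Var 0) \<in> T"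
    using assms(3) by (intro app T_refl T_inst)
  have 2: "(inst M (\<lambda>j. Var (Suc j)) \<cdot> Var 0, P) \<in> T" if "M \<leadsto> Abs P" for M P
  proof -
    have "inst M (\<lambda>j. Var (Suc j)) \<cdot> Var 0 \<leadsto> inst (Abs P) (\<lambda>j. Var (Suc j)) \<cdot> Var 0"
      using that by (intro app_left whrs_inst)
    also have "\<dots> \<leadsto> inst P (scons (Var 0) (\<lambda>j. Var (Suc j)))"
      by (simp add: redex_up)
    also have "scons (Var 0) (\<lambda>j. Var (Suc j)) = Var"
      by (auto simp: scons_def fun_eq_iff split: nat.split)
    finally show ?thesis by (simp add: T_whrs)
  qed
  have "(P, Q) \<in> T"
    by (rule T_square[OF 1 2[OF P(2)] 2[OF Q(2)]])
  then show ?thesis using rep_separate P Q assms(4) by blast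
qed

end

section \<open>Regular monoids with commuting idempotents\<close>

text \<open>Commuting idempotents make the inverse of a regular element unique, so a chosen inverse
  satisfies every law that some inverse satisfies.\<close>

lemma (in monoid) inverse_monoidI:
  assumes reg: "\<And>u. u \<in> carrier G \<Longrightarrow> \<exists>v\<in>carrier G. u \<otimes> v \<otimes> u = u \<and> v \<otimes> u \<otimes> v = v"
    and comm: "\<And>e f. idempotent G e \<Longrightarrow> idempotent G f \<Longrightarrow> e \<otimes> f = f \<otimes> e"
  shows "\<exists>star. inverse_monoid G star"
proof -
  define I where "I u v \<longleftrightarrow> u \<in> carrier G \<and> v \<in> carrier G \<and> u \<otimes> v \<otimes> u = u \<and> v \<otimes> u \<otimes> v = v" for u v
  have I_sym: "I v u" if "I u v" for u v using that by (auto simp: I_def)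
  have idem: "idempotent G (u \<otimes> v)" if "I u v" for u v
  proof -
    have "u \<in> carrier G" "v \<in> carrier G" using that by (simp_all add: I_def)
    then have "u \<otimes> v \<otimes> (u \<otimes> v) = u \<otimes> v \<otimes> u \<otimes> v" by (simp add: m_assoc)
    also have "\<dots> = u \<otimes> v" using that by (simp add: I_def)
    finally show ?thesis using that by (simp add: I_def idempotent_def)
  qed
  have uniq: "v = w" if v: "I u v" and w: "I u w" for u v w
  proof -
    have c: "u \<in> carrier G" "v \<in> carrier G" "w \<in> carrier G" using v w by (auto simp: I_def)
    have absorb: "x \<otimes> y \<otimes> (x \<otimes> z) = x \<otimes> z" "z \<otimes> x \<otimes> (y \<otimes> x) = z \<otimes> x"
      if "I x y" "z \<in> carrier G" for x y z
    proof -
      have "x \<in> carrier G" "y \<in> carrier G" using that by (simp_all add: I_def)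
      with that(2) have "x \<otimes> y \<otimes> (x \<otimes> z) = x \<otimes> y \<otimes> x \<otimes> z"
        "z \<otimes> x \<otimes> (y \<otimes> x) = z \<otimes> (x \<otimes> y \<otimes> x)"
        by (simp_all add: m_assoc)
      then show "x \<otimes> y \<otimes> (x \<otimes> z) = x \<otimes> z" "z \<otimes> x \<otimes> (y \<otimes> x) = z \<otimes> x"
        using that by (simp_all add: I_def)
    qed
    \<comment> \<open>\<open>(u v)(u w) = u w\<close> and \<open>(u w)(u v) = u v\<close>, so
      commutation gives \<open>u v = u w\<close>; dually \<open>v u = w u\<close>.\<close>
    note uv = absorb(1)[OF v c(3)] absorb(1)[OF w c(2)] absorb(2)[OF w c(2)] absorb(2)[OF v c(3)]
    have 1: "u \<otimes> v = u \<otimes> w" using comm[OF idem[OF v] idem[OF w]] unfolding uv by (rule sym)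
    have 2: "v \<otimes> u = w \<otimes> u" using comm[OF idem[OF I_sym[OF v]] idem[OF I_sym[OF w]]] unfolding uv .
    have "v = v \<otimes> u \<otimes> v" using v by (simp add: I_def)
    also have "\<dots> = w \<otimes> (u \<otimes> v)" unfolding 2 using c by (simp add: m_assoc)
    also have "\<dots> = w \<otimes> u \<otimes> w" unfolding 1 using c by (simp add: m_assoc)
    also have "\<dots> = w" using w by (simp add: I_def)
    finally show ?thesis .
  qed
  define star where "star u = (SOME v. I u v)" for u
  have star: "I u (star u)" if "u \<in> carrier G" for u
    unfolding star_def using reg[OF that] that by (intro someI_ex[of "I u"]) (auto simp: I_def)
  have star_eq: "star u = v" if "I u v" for u v
  proof (rule uniq[OF star that])
    show "u \<in> carrier G" using that by (simp add: I_def)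
  qed
  have "inverse_monoid G star"
  proof
    fix u assume u: "u \<in> carrier G"
    show "star u \<in> carrier G" using star[OF u] by (simp add: I_def)
    show "star (star u) = u" by (rule star_eq[OF I_sym[OF star[OF u]]])
    show "u \<otimes> star u \<otimes> u = u" using star[OF u] by (simp add: I_def)
    fix v assume v: "v \<in> carrier G"
    have c: "star u \<in> carrier G" "star v \<in> carrier G" using star[OF u] star[OF v] by (auto simp: I_def)
    have "u \<otimes> star u \<otimes> (v \<otimes> star v) = v \<otimes> star v \<otimes> (u \<otimes> star u)"
      by (rule comm[OF idem[OF star[OF u]] idem[OF star[OF v]]])
    then show "u \<otimes> star u \<otimes> v \<otimes> star v = v \<otimes> star v \<otimes> u \<otimes> star u"
      using u v c by (simp add: m_assoc)
    \<comment> \<open>Exchanging these two idempotents in the middle shows that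
      \<open>star v\<close> times \<open>star u\<close> is an inverse of \<open>u\<close> times
      \<open>v\<close>.\<close>
    have swap: "star u \<otimes> u \<otimes> (v \<otimes> star v) = v \<otimes> star v \<otimes> (star u \<otimes> u)"
      using comm[OF idem[OF I_sym[OF star[OF u]]] idem[OF star[OF v]]] .
    have "u \<otimes> v \<otimes> (star v \<otimes> star u) \<otimes> (u \<otimes> v) = u \<otimes> (v \<otimes> star v \<otimes> (star u \<otimes> u)) \<otimes> v"
      using u v c by (simp add: m_assoc)
    also have "\<dots> = u \<otimes> star u \<otimes> u \<otimes> (v \<otimes> star v \<otimes> v)"
      unfolding swap[symmetric] using u v c by (simp add: m_assoc)
    also have "\<dots> = u \<otimes> v" using star[OF u] star[OF v] by (simp add: I_def)
    finally have 1: "u \<otimes> v \<otimes> (star v \<otimes> star u) \<otimes> (u \<otimes> v) = u \<otimes> v" .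
    have "star v \<otimes> star u \<otimes> (u \<otimes> v) \<otimes> (star v \<otimes> star u)
        = star v \<otimes> (star u \<otimes> u \<otimes> (v \<otimes> star v)) \<otimes> star u"
      using u v c by (simp add: m_assoc)
    also have "\<dots> = star v \<otimes> v \<otimes> star v \<otimes> (star u \<otimes> u \<otimes> star u)"
      unfolding swap using u v c by (simp add: m_assoc)
    also have "\<dots> = star v \<otimes> star u" using star[OF u] star[OF v] by (simp add: I_def)
    finally show "star (u \<otimes> v) = star v \<otimes> star u"
      using 1 u v c by (intro star_eq) (simp add: I_def)
  qed
  then show ?thesis by blast
qed

section \<open>The quotient\<close>

locale boehm_theory = lambda_theory +
  assumes bt: "bt_theory \<subseteq> T"
begin

text \<open>A relation, since a class may admit trees of several arities; a tree, however,
  determines its class.\<close>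

definition cls :: "ptree \<Rightarrow> trm set \<Rightarrow> bool" where
  "cls p U \<longleftrightarrow> (\<exists>M. Rep p M \<and> U = T `` {M})"

lemma class_eq: "T `` {M} = T `` {N} \<longleftrightarrow> (M, N) \<in> T"
  using eq_equiv_class_iff[OF equiv] by simp

lemma HP_class_iff: "U \<in> HP // T \<longleftrightarrow> (\<exists>p. cls p U)"
proof -
  have "U \<in> HP // T \<longleftrightarrow> (\<exists>M\<in>HP. U = T `` {M})" by (auto simp: quotient_def)
  then show ?thesis by (auto simp: cls_def HP_iff_Rep Bex_def)
qed

lemma cls_good: "cls p U \<Longrightarrow> good p"
  by (auto simp: cls_def Rep_def)

lemma cls_unique: "cls p U \<Longrightarrow> cls p V \<Longrightarrow> U = V"
proof -
  assume "cls p U" "cls p V"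
  then obtain M N where "Rep p M" "Rep p N" and UV: "U = T `` {M}" "V = T `` {N}"
    unfolding cls_def by blast
  then have "BT M = BT N" by (intro Rep_unique)
  then have "(M, N) \<in> bt_theory" by (simp add: bt_theory_def)
  with bt show ?thesis unfolding UV class_eq by blast
qed

lemma cls_mult: "cls p U \<Longrightarrow> cls q V \<Longrightarrow> cls (pcomp p q) (U \<otimes>\<^bsub>Lam_quot T\<^esub> V)"
  unfolding cls_def using mult_class Rep_pcomp by blast

lemma cls_one: "cls triv \<one>\<^bsub>Lam_quot T\<^esub>"
  unfolding cls_def Lam_quot_def using Rep_I by (intro exI[of _ I_trm]) simp

text \<open>Two distinct classes of hereditary permutations serve as the witness of
  consistency.\<close>

lemma cls_separate:
  assumes "cls p U" "cls q U" "cls r V" "cls s W" "V \<noteq> W"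
  shows "snd (p w) = snd (q w)"
proof -
  from assms(3-5) obtain X Y where "(X, Y) \<notin> T" by (auto simp: cls_def class_eq)
  moreover from assms(1,2) obtain M N where "Rep p M" "Rep q N" "(M, N) \<in> T"
    unfolding cls_def by (metis class_eq)
  ultimately show ?thesis using Rep_separate by blast
qed

lemma submonoid_HP: "submonoid (HP // T) (Lam_quot T)"
proof
  show "HP // T \<subseteq> carrier (Lam_quot T)" by (auto simp: Lam_quot_def quotient_def)
  show "x \<otimes>\<^bsub>Lam_quot T\<^esub> y \<in> HP // T" if "x \<in> HP // T" "y \<in> HP // T" for x y
    using that cls_mult unfolding HP_class_iff by blast
  show "\<one>\<^bsub>Lam_quot T\<^esub> \<in> HP // T"
    using cls_one HP_class_iff by blast
qed

lemma monoid_HP: "monoid (HP_quot T)"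
proof (rule monoidI, simp_all)
  show "x \<otimes>\<^bsub>Lam_quot T\<^esub> y \<in> HP // T" if "x \<in> HP // T" "y \<in> HP // T" for x y
    using that submonoid.m_closed[OF submonoid_HP] by blast
  show "\<one>\<^bsub>Lam_quot T\<^esub> \<in> HP // T"
    using submonoid.one_closed[OF submonoid_HP] .
  show "x \<otimes>\<^bsub>Lam_quot T\<^esub> y \<otimes>\<^bsub>Lam_quot T\<^esub> z = x \<otimes>\<^bsub>Lam_quot T\<^esub> (y \<otimes>\<^bsub>Lam_quot T\<^esub> z)"
    if "x \<in> HP // T" "y \<in> HP // T" "z \<in> HP // T" for x y z
  proof -
    from that obtain L M N where xyz: "x = T `` {L}" "y = T `` {M}" "z = T `` {N}"
      by (auto elim!: quotientE)
    show ?thesis unfolding xyz mult_class class_eq by (rule comp_assoc)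
  qed
  show "\<one>\<^bsub>Lam_quot T\<^esub> \<otimes>\<^bsub>Lam_quot T\<^esub> x = x" if "x \<in> HP // T" for x
    using that cls_mult[OF cls_one] cls_unique unfolding HP_class_iff by (metis pcomp_triv(1))
  show "x \<otimes>\<^bsub>Lam_quot T\<^esub> \<one>\<^bsub>Lam_quot T\<^esub> = x" if "x \<in> HP // T" for x
    using that cls_mult[OF _ cls_one] cls_unique unfolding HP_class_iff by (metis pcomp_triv(2))
qed

lemma idempotent_pdiag:
  assumes "idempotent (HP_quot T) e" "cls p e" "cls r V" "cls s W" "V \<noteq> W"
  shows "pdiag p"
proof -
  have "e \<otimes>\<^bsub>Lam_quot T\<^esub> e = e" using assms(1) by (simp add: idempotent_def)
  then have "cls (pcomp p p) e" using cls_mult[OF assms(2) assms(2)] by simp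
  then show ?thesis
    using cls_separate[OF _ assms(2-5)] cls_good[OF assms(2)] by (intro pdiag_if_idem) blast+
qed

lemma inverse_monoid_HP: "\<exists>star. inverse_monoid (HP_quot T) star"
proof (rule monoid.inverse_monoidI[OF monoid_HP], simp_all)
  fix u assume "u \<in> HP // T"
  then obtain p where u: "cls p u" using HP_class_iff by blast
  then obtain v where v: "cls (pinv p) v"
    unfolding cls_def by (metis Rep_pinv)
  note p = cls_good[OF u] and p' = good_pinv[OF cls_good[OF u]]
  have "u \<otimes>\<^bsub>Lam_quot T\<^esub> v \<otimes>\<^bsub>Lam_quot T\<^esub> u = u"
    using cls_mult[OF cls_mult[OF u v] u] u cls_unique by (simp add: pcomp_pinv_pcomp(1)[OF p])
  moreover have "v \<otimes>\<^bsub>Lam_quot T\<^esub> u \<otimes>\<^bsub>Lam_quot T\<^esub> v = v"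
    using cls_mult[OF cls_mult[OF v u] v] v cls_unique pcomp_pinv_pcomp(1)[OF p']
    by (simp add: pinv_pinv[OF p])
  ultimately show "\<exists>v\<in>HP // T. u \<otimes>\<^bsub>Lam_quot T\<^esub> v \<otimes>\<^bsub>Lam_quot T\<^esub> u = u
      \<and> v \<otimes>\<^bsub>Lam_quot T\<^esub> u \<otimes>\<^bsub>Lam_quot T\<^esub> v = v"
    using v HP_class_iff by blast
next
  fix e f assume e: "idempotent (HP_quot T) e" and f: "idempotent (HP_quot T) f"
  then obtain p q where p: "cls p e" and q: "cls q f"
    by (auto simp: idempotent_def HP_class_iff)
  note ef = cls_mult[OF p q] and fe = cls_mult[OF q p]
  show "e \<otimes>\<^bsub>Lam_quot T\<^esub> f = f \<otimes>\<^bsub>Lam_quot T\<^esub> e"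
  \<comment> \<open>If the two products differ, they are themselves the distinct classes that
    separation asks for.\<close>
  proof (rule ccontr)
    assume "e \<otimes>\<^bsub>Lam_quot T\<^esub> f \<noteq> f \<otimes>\<^bsub>Lam_quot T\<^esub> e"
    then have "pdiag p" "pdiag q"
      using idempotent_pdiag ef fe e f p q by blast+
    then have "pcomp p q = pcomp q p" by (rule pcomp_pdiag_commute)
    with ef fe cls_unique \<open>e \<otimes>\<^bsub>Lam_quot T\<^esub> f \<noteq> f \<otimes>\<^bsub>Lam_quot T\<^esub> e\<close> show False by simp
  qed
qed

lemma E_unitary_HP:
  assumes "inverse_monoid (HP_quot T) star"
  shows "E_unitary_inverse_monoid (HP_quot T) star"
proof -
  interpret inverse_monoid "HP_quot T" star by (rule assms)
  show ?thesis
  proof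
    fix e v assume e: "idempotent (HP_quot T) e" and v: "v \<in> carrier (HP_quot T)" and le: "nat_le e v"
    have ec: "e \<in> carrier (HP_quot T)" using e by (simp add: idempotent_def)
    \<comment> \<open>By the natural order \<open>e\<close> is \<open>f\<close> times
      \<open>v\<close>, with both \<open>e\<close> and \<open>f\<close> idempotent, so the
      permutations of \<open>v\<close> can be cancelled down to the identity.\<close>
    define f where "f = e \<otimes>\<^bsub>HP_quot T\<^esub> star e"
    have f: "idempotent (HP_quot T) f"
      using ec star_closed[OF ec] mult_star_mult[OF ec] unfolding idempotent_def f_def
      by (metis m_assoc m_closed)
    have fv: "f \<otimes>\<^bsub>Lam_quot T\<^esub> v = e" using le by (simp add: nat_le_def f_def)
    obtain p q r where p: "cls p e" and q: "cls q v" and r: "cls r f"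
      using ec v f by (auto simp: idempotent_def HP_class_iff)
    have "v \<otimes>\<^bsub>Lam_quot T\<^esub> v = v"
    proof (rule ccontr)
      assume ne: "v \<otimes>\<^bsub>Lam_quot T\<^esub> v \<noteq> v"
      note vv = cls_mult[OF q q]
      have "cls (pcomp r q) e" using cls_mult[OF r q] fv by simp
      then have "pdiag r" "pdiag (pcomp r q)"
        using idempotent_pdiag[OF f r vv q ne] idempotent_pdiag[OF e _ vv q ne] by blast+
      then have "pdiag q" using pdiag_cancel by blast
      with vv q cls_unique ne show False by (simp add: pcomp_pdiag_idem)
    qed
    with v show "idempotent (HP_quot T) v" by (simp add: idempotent_def)
  qed
qed

end

theorem theorem4p8:
  fixes T :: "trm rel"
  assumes "lambda_theory T" and "bt_theory \<subseteq> T"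
  shows "submonoid (HP // T) (Lam_quot T) \<and>
    (\<exists>star. E_unitary_inverse_monoid (HP_quot T) star)"
proof -
  interpret boehm_theory T
    using assms by (simp add: boehm_theory_def boehm_theory_axioms_def)
  show ?thesis
    using submonoid_HP inverse_monoid_HP E_unitary_HP by blast
qed

end
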